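(* Let $\Gamma$ be a simple graph on $V=\{1,\dots,n\}$ with edge ideal $I\subseteq k[x_1,\dots,x_n]$ and let $F$ be a cover of $\Gamma$. Then $P_F$ is an associated prime of $I^3$ if and only if $F$ is a minimal cover or $F$ is minimal among the covers containing the closed neighborhood of the vertex set of a subgraph of $\Gamma$ of one of the following forms: a triangle, a union of an edge and a triangle meeting at a vertex, a union of two non-adjacent triangles, a union of two triangles meeting at a vertex, a pentagon.
   Context: $k$ is a field, $n\ge 1$. The edge ideal of $\Gamma$ is the ideal generated by the $x_ix_j$ with $\{i,j\}$ an edge of $\Gamma$. A cover of $\Gamma$ is a set of vertices meeting every edge; a minimal cover is one minimal under inclusion. For $F\subseteq V$, $P_F$ is the ideal generated by the variables $x_i$, $i\in F$. For $U\subseteq V$, the closed neighborhood $N[U]$ is the union of $U$ and the set of vertices adjacent to some vertex of $U$. "$F$ is minimal among the covers containing $N$" means that $F$ is a cover containing $N$ and no proper subset of $F$ is a cover containing $N$. Subgraphs need not be induced. "Meeting at a vertex" means having exactly one vertex in common. Two triangles are non-adjacent if they are vertex-disjoint and no edge of $\Gamma$ joins a vertex of one to a vertex of the other. A pentagon is a cycle of length 5. *)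

theory Defs
  imports
    "HOL-Library.Poly_Mapping"
    "HOL-Algebra.Ideal_Product"
begin

section \<open>Graphs\<close>

text \<open>A graph is given by its vertex set and its edge set, edges being two-element sets of vertices.\<close>

definition simple_graph :: "'v set \<Rightarrow> 'v set set \<Rightarrow> bool" where
  "simple_graph V E \<longleftrightarrow> finite V \<and> (\<forall>e\<in>E. e \<subseteq> V \<and> card e = 2)"

definition subgraph :: "'v set \<Rightarrow> 'v set set \<Rightarrow> 'v set \<Rightarrow> 'v set set \<Rightarrow> bool" where
  "subgraph W D V E \<longleftrightarrow> simple_graph W D \<and> W \<subseteq> V \<and> D \<subseteq> E"

definition cover :: "'v set \<Rightarrow> 'v set set \<Rightarrow> 'v set \<Rightarrow> bool" where
  "cover V E F \<longleftrightarrow> F \<subseteq> V \<and> (\<forall>e\<in>E. e \<inter> F \<noteq> {})"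

definition minimal_cover :: "'v set \<Rightarrow> 'v set set \<Rightarrow> 'v set \<Rightarrow> bool" where
  "minimal_cover V E F \<longleftrightarrow> cover V E F \<and> (\<forall>G. G \<subset> F \<longrightarrow> \<not> cover V E G)"

definition minimal_cover_containing :: "'v set \<Rightarrow> 'v set set \<Rightarrow> 'v set \<Rightarrow> 'v set \<Rightarrow> bool" where
  "minimal_cover_containing V E N F \<longleftrightarrow>
     cover V E F \<and> N \<subseteq> F \<and> (\<forall>G. G \<subset> F \<longrightarrow> \<not> (cover V E G \<and> N \<subseteq> G))"

definition closed_nbhd :: "'v set \<Rightarrow> 'v set set \<Rightarrow> 'v set \<Rightarrow> 'v set" where
  "closed_nbhd V E U = U \<union> {v \<in> V. \<exists>u\<in>U. {u, v} \<in> E}"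

definition is_edge :: "'v set \<Rightarrow> 'v set set \<Rightarrow> bool" where
  "is_edge W D \<longleftrightarrow> (\<exists>a b. a \<noteq> b \<and> W = {a, b} \<and> D = {{a, b}})"

definition is_triangle :: "'v set \<Rightarrow> 'v set set \<Rightarrow> bool" where
  "is_triangle W D \<longleftrightarrow> (\<exists>a b c. distinct [a, b, c] \<and> W = {a, b, c} \<and>
     D = {{a, b}, {b, c}, {c, a}})"

definition is_pentagon :: "'v set \<Rightarrow> 'v set set \<Rightarrow> bool" where
  "is_pentagon W D \<longleftrightarrow> (\<exists>a b c d e. distinct [a, b, c, d, e] \<and> W = {a, b, c, d, e} \<and>
     D = {{a, b}, {b, c}, {c, d}, {d, e}, {e, a}})"

definition is_edge_triangle_meeting :: "'v set \<Rightarrow> 'v set set \<Rightarrow> bool" where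
  "is_edge_triangle_meeting W D \<longleftrightarrow> (\<exists>A B C T. is_edge A B \<and> is_triangle C T \<and>
     card (A \<inter> C) = 1 \<and> W = A \<union> C \<and> D = B \<union> T)"

definition is_triangles_meeting :: "'v set \<Rightarrow> 'v set set \<Rightarrow> bool" where
  "is_triangles_meeting W D \<longleftrightarrow> (\<exists>A S C T. is_triangle A S \<and> is_triangle C T \<and>
     card (A \<inter> C) = 1 \<and> W = A \<union> C \<and> D = S \<union> T)"

text \<open>Non-adjacency refers to the edge set \<open>E\<close> of the ambient graph, not only to \<open>D\<close>.\<close>

definition is_nonadjacent_triangles :: "'v set set \<Rightarrow> 'v set \<Rightarrow> 'v set set \<Rightarrow> bool" where
  "is_nonadjacent_triangles E W D \<longleftrightarrow> (\<exists>A S C T. is_triangle A S \<and> is_triangle C T \<and>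
     A \<inter> C = {} \<and> (\<forall>x\<in>A. \<forall>y\<in>C. {x, y} \<notin> E) \<and> W = A \<union> C \<and> D = S \<union> T)"


section \<open>Polynomial rings and edge ideals\<close>

text \<open>
  \<open>mpoly_ring V\<close> is the polynomial ring in the variables indexed by \<open>V\<close>: a monomial is its
  finitely supported exponent function, a polynomial is a finitely supported function from
  monomials to coefficients, and the product is the convolution product of \<^theory>\<open>HOL-Library.Poly_Mapping\<close>.
\<close>

definition mpoly_ring :: "'v set \<Rightarrow> (('v \<Rightarrow>\<^sub>0 nat) \<Rightarrow>\<^sub>0 'k::field) ring" where
  "mpoly_ring V = \<lparr>carrier = {p. \<forall>m\<in>Poly_Mapping.keys p. Poly_Mapping.keys m \<subseteq> V},
     mult = (*), one = 1, zero = 0, add = (+)\<rparr>"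

definition var :: "'v \<Rightarrow> ('v \<Rightarrow>\<^sub>0 nat) \<Rightarrow>\<^sub>0 'k::field" where
  "var i = Poly_Mapping.single (Poly_Mapping.single i 1) 1"

definition edge_ideal :: "'v set \<Rightarrow> 'v set set \<Rightarrow> (('v \<Rightarrow>\<^sub>0 nat) \<Rightarrow>\<^sub>0 'k::field) set" where
  "edge_ideal V E = Idl\<^bsub>mpoly_ring V\<^esub> {var i * var j | i j. {i, j} \<in> E}"

definition var_ideal :: "'v set \<Rightarrow> 'v set \<Rightarrow> (('v \<Rightarrow>\<^sub>0 nat) \<Rightarrow>\<^sub>0 'k::field) set" where
  "var_ideal V F = Idl\<^bsub>mpoly_ring V\<^esub> (var ` F)"

text \<open>
  An associated prime of the ideal \<open>J\<close> is an associated prime of the module \<open>R/J\<close>: a prime ideal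
  that is the annihilator of the class of some \<open>f\<close>, i.e. the colon ideal \<open>(J : f)\<close>.
\<close>

definition associated_prime :: "('a, 'b) ring_scheme \<Rightarrow> 'a set \<Rightarrow> 'a set \<Rightarrow> bool" where
  "associated_prime R J P \<longleftrightarrow> primeideal P R \<and>
     (\<exists>f\<in>carrier R. P = {r \<in> carrier R. r \<otimes>\<^bsub>R\<^esub> f \<in> J})"

lemma cring_mpoly_ring: "cring (mpoly_ring V :: (('v \<Rightarrow>\<^sub>0 nat) \<Rightarrow>\<^sub>0 'k::field) ring)"
proof (rule cringI)
  let ?R = "mpoly_ring V :: (('v \<Rightarrow>\<^sub>0 nat) \<Rightarrow>\<^sub>0 'k) ring"
  have carr: "p \<in> carrier ?R \<longleftrightarrow> (\<forall>m\<in>Poly_Mapping.keys p. Poly_Mapping.keys m \<subseteq> V)" for p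
    by (simp add: mpoly_ring_def)
  have ops: "p \<oplus>\<^bsub>?R\<^esub> q = p + q" "p \<otimes>\<^bsub>?R\<^esub> q = p * q" "\<zero>\<^bsub>?R\<^esub> = 0" "\<one>\<^bsub>?R\<^esub> = 1" for p q
    by (simp_all add: mpoly_ring_def)
  have add: "p + q \<in> carrier ?R" if "p \<in> carrier ?R" "q \<in> carrier ?R" for p q
    using that Poly_Mapping.keys_add[of p q] unfolding carr by blast
  have mult: "p * q \<in> carrier ?R" if "p \<in> carrier ?R" "q \<in> carrier ?R" for p q
    unfolding carr
  proof
    fix m assume "m \<in> Poly_Mapping.keys (p * q)"
    then obtain a b where m: "m = a + b"
      and a: "a \<in> Poly_Mapping.keys p" and b: "b \<in> Poly_Mapping.keys q"
      using keys_mult[of p q] by blast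
    have "Poly_Mapping.keys a \<subseteq> V" "Poly_Mapping.keys b \<subseteq> V"
      using that a b unfolding carr by blast+
    then show "Poly_Mapping.keys m \<subseteq> V"
      unfolding m using Poly_Mapping.keys_add[of a b] by blast
  qed
  show "abelian_group ?R"
  proof (rule abelian_groupI, unfold ops)
    fix p assume "p \<in> carrier ?R"
    then have "- p \<in> carrier ?R"
      unfolding carr by simp
    then show "\<exists>q\<in>carrier ?R. q + p = 0"
      by (rule bexI[rotated]) simp
  next
    show "(0 :: ('v \<Rightarrow>\<^sub>0 nat) \<Rightarrow>\<^sub>0 'k) \<in> carrier ?R" by (simp add: carr)
  qed (rule add.assoc add.commute add_0_left | (rule add, assumption, assumption))+
  show "comm_monoid ?R"
  proof (rule comm_monoidI, unfold ops)
    show "(1 :: ('v \<Rightarrow>\<^sub>0 nat) \<Rightarrow>\<^sub>0 'k) \<in> carrier ?R" by (simp add: carr)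
  qed (rule mult.assoc mult.commute mult_1_left | (rule mult, assumption, assumption))+
  fix p q r :: "('v \<Rightarrow>\<^sub>0 nat) \<Rightarrow>\<^sub>0 'k"
  show "(p \<oplus>\<^bsub>?R\<^esub> q) \<otimes>\<^bsub>?R\<^esub> r = p \<otimes>\<^bsub>?R\<^esub> r \<oplus>\<^bsub>?R\<^esub> q \<otimes>\<^bsub>?R\<^esub> r"
    unfolding ops by (rule distrib_right)
qed

end

theory Submission
  imports Defs
begin

text \<open>
  Some monomial \<open>m\<close> of a polynomial \<open>f\<close> with \<open>P\<^sub>F = (I\<^sup>3 : f)\<close> satisfies \<open>P\<^sub>F = (I\<^sup>3 : m)\<close>, so the
  theorem is a statement about products of three edges. Let \<open>B\<close> be the set of vertices of \<open>F\<close>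
  without neighbor outside \<open>F\<close>. Then \<open>F\<close> is a minimal cover iff \<open>B\<close> is empty, and it is minimal
  among the covers containing \<open>N[W]\<close> iff \<open>W \<subseteq> B \<subseteq> N[W]\<close>.

  Regard \<open>m\<close> as a graph \<open>H\<close> with one copy of a vertex for each unit of its exponent, two copies
  being adjacent when the vertices are. Then \<open>H\<close> has matching number two, and a vertex \<open>i\<close>
  satisfies \<open>x\<^sub>i m \<in> I\<^sup>3\<close> iff it is adjacent to a vertex missed by a maximum matching of \<open>H\<close>. As in the
  Gallai-Edmonds theorem, the missed vertices over \<open>B\<close> form factor-critical components of \<open>H\<close>.
  Having neighbors among themselves, they form a triangle, two disjoint non-adjacent triangles,
  two triangles meeting at a vertex or a 5-cycle. They dominate \<open>B\<close>, and identifying copies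
  turns these graphs into the listed ones. Conversely, the product of the vertices of a listed
  subgraph, two of them squared for a triangle and one for an edge and a triangle, is such a
  monomial once it is multiplied by the vertices outside \<open>F\<close>.
\<close>

section \<open>Monomial ideals\<close>

definition multiples :: "('v \<Rightarrow>\<^sub>0 nat) set \<Rightarrow> ('v \<Rightarrow>\<^sub>0 nat) set" where
  "multiples G = {g + h | g h. g \<in> G}"

text \<open>Membership in an ideal generated by monomials is decided term by term, so it is encoded
  as a condition on the support. Monomials are exponent functions: \<open>+\<close> is their
  product, and \<open>multiples G\<close> consists of the monomials with a divisor in
  \<open>G\<close>.\<close>

definition monomial_ideal ::
    "'v set \<Rightarrow> ('v \<Rightarrow>\<^sub>0 nat) set \<Rightarrow> (('v \<Rightarrow>\<^sub>0 nat) \<Rightarrow>\<^sub>0 'k::field) set" where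
  "monomial_ideal V G = {p \<in> carrier (mpoly_ring V). Poly_Mapping.keys p \<subseteq> multiples G}"

lemma keys_add_nat:
  fixes a b :: "'v \<Rightarrow>\<^sub>0 nat"
  shows "Poly_Mapping.keys (a + b) = Poly_Mapping.keys a \<union> Poly_Mapping.keys b"
  by (auto simp: in_keys_iff lookup_add)

lemma add_in_multiples: "m \<in> multiples G \<Longrightarrow> k + m \<in> multiples G"
  unfolding multiples_def by (force simp: add_ac)

lemma sum_single_lookup:
  fixes p :: "'a \<Rightarrow>\<^sub>0 'b::comm_monoid_add"
  shows "(\<Sum>k\<in>Poly_Mapping.keys p. Poly_Mapping.single k (Poly_Mapping.lookup p k)) = p"
  by (rule poly_mapping_eqI)
    (auto simp: lookup_sum lookup_single when_def sum.delta not_in_keys_iff_lookup_eq_zero)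

text \<open>Shifting exponents by \<open>m\<close> is injective, so no two terms merge.\<close>

lemma keys_mult_monomial:
  fixes p :: "('v \<Rightarrow>\<^sub>0 nat) \<Rightarrow>\<^sub>0 'k::field"
  shows "Poly_Mapping.keys (p * Poly_Mapping.single m 1) = (\<lambda>k. k + m) ` Poly_Mapping.keys p"
proof
  show "Poly_Mapping.keys (p * Poly_Mapping.single m 1) \<subseteq> (\<lambda>k. k + m) ` Poly_Mapping.keys p"
    using keys_mult[of p "Poly_Mapping.single m 1"] by auto
  have "Poly_Mapping.lookup (p * Poly_Mapping.single m 1) (j + m) = Poly_Mapping.lookup p j" for j
  proof -
    have "p * Poly_Mapping.single m 1 =
        (\<Sum>k\<in>Poly_Mapping.keys p. Poly_Mapping.single (k + m) (Poly_Mapping.lookup p k))"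
      by (subst sum_single_lookup[of p, symmetric]) (simp add: sum_distrib_right mult_single)
    then show ?thesis
      by (auto simp: lookup_sum lookup_single when_def sum.delta not_in_keys_iff_lookup_eq_zero)
  qed
  then show "(\<lambda>k. k + m) ` Poly_Mapping.keys p \<subseteq> Poly_Mapping.keys (p * Poly_Mapping.single m 1)"
    by (auto simp: in_keys_iff)
qed

lemma mpoly_ring_simps:
  "p \<in> carrier (mpoly_ring V) \<longleftrightarrow> (\<forall>m\<in>Poly_Mapping.keys p. Poly_Mapping.keys m \<subseteq> V)"
  "p \<oplus>\<^bsub>mpoly_ring V\<^esub> q = p + q" "p \<otimes>\<^bsub>mpoly_ring V\<^esub> q = p * q"
  "\<zero>\<^bsub>mpoly_ring V\<^esub> = 0" "\<one>\<^bsub>mpoly_ring V\<^esub> = 1"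
  by (simp_all add: mpoly_ring_def)

lemma a_inv_mpoly_ring:
  assumes "p \<in> carrier (mpoly_ring V)"
  shows "\<ominus>\<^bsub>mpoly_ring V\<^esub> p = - p"
proof -
  interpret cring "mpoly_ring V" by (rule cring_mpoly_ring)
  have "- p \<in> carrier (mpoly_ring V)"
    using assms by (simp add: mpoly_ring_simps)
  then show ?thesis
    using minus_equality[of "- p" p] assms by (simp add: mpoly_ring_simps)
qed

lemma ideal_monomial_ideal:
  "ideal (monomial_ideal V G :: (('v \<Rightarrow>\<^sub>0 nat) \<Rightarrow>\<^sub>0 'k::field) set) (mpoly_ring V)"
proof -
  let ?R = "mpoly_ring V :: (('v \<Rightarrow>\<^sub>0 nat) \<Rightarrow>\<^sub>0 'k::field) ring"
  interpret cring ?R by (rule cring_mpoly_ring)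
  have mult: "x * a \<in> monomial_ideal V G"
    if "a \<in> monomial_ideal V G" "x \<in> carrier ?R" for a x
  proof -
    have "x * a \<in> carrier ?R"
      using m_closed[of x a] that by (simp add: monomial_ideal_def mpoly_ring_simps(3))
    moreover have "Poly_Mapping.keys (x * a) \<subseteq> multiples G"
      using keys_mult[of x a] that by (auto simp: monomial_ideal_def intro: add_in_multiples)
    ultimately show ?thesis by (simp add: monomial_ideal_def)
  qed
  show ?thesis
  proof (rule idealI)
    show "subgroup (monomial_ideal V G) (add_monoid ?R)"
    proof (rule add.subgroupI)
      show "monomial_ideal V G \<subseteq> carrier ?R"
        by (auto simp: monomial_ideal_def)
      have "0 \<in> monomial_ideal V G"
        by (simp add: monomial_ideal_def mpoly_ring_simps)
      then show "monomial_ideal V G \<noteq> {}" by blast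
    next
      fix a :: "('v \<Rightarrow>\<^sub>0 nat) \<Rightarrow>\<^sub>0 'k" assume "a \<in> monomial_ideal V G"
      then show "\<ominus>\<^bsub>?R\<^esub> a \<in> monomial_ideal V G"
        by (simp add: monomial_ideal_def a_inv_mpoly_ring) (simp add: mpoly_ring_simps)
    next
      fix a b :: "('v \<Rightarrow>\<^sub>0 nat) \<Rightarrow>\<^sub>0 'k"
      assume "a \<in> monomial_ideal V G" "b \<in> monomial_ideal V G"
      then show "a \<oplus>\<^bsub>?R\<^esub> b \<in> monomial_ideal V G"
        using add.m_closed[of a b] keys_add[of a b]
        by (auto simp: monomial_ideal_def mpoly_ring_simps(2))
    qed
  next
    fix a x :: "('v \<Rightarrow>\<^sub>0 nat) \<Rightarrow>\<^sub>0 'k"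
    assume ax: "a \<in> monomial_ideal V G" "x \<in> carrier ?R"
    then show "x \<otimes>\<^bsub>?R\<^esub> a \<in> monomial_ideal V G" "a \<otimes>\<^bsub>?R\<^esub> x \<in> monomial_ideal V G"
      using mult[OF ax] by (simp_all add: mpoly_ring_simps(3) Groups.mult.commute)
  qed (rule ring_axioms)
qed

text \<open>A polynomial is the finite sum of its terms, and each term here is a generator times a
  term \<open>h\<close> whose variables again lie in \<open>V\<close>.\<close>

lemma monomial_ideal_minimal:
  fixes J :: "(('v \<Rightarrow>\<^sub>0 nat) \<Rightarrow>\<^sub>0 'k::field) set"
  assumes J: "ideal J (mpoly_ring V)"
    and G: "\<And>g. g \<in> G \<Longrightarrow> Poly_Mapping.single g 1 \<in> J"
  shows "monomial_ideal V G \<subseteq> J"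
proof
  fix p :: "('v \<Rightarrow>\<^sub>0 nat) \<Rightarrow>\<^sub>0 'k"
  interpret ideal J "mpoly_ring V" by (rule J)
  assume p: "p \<in> monomial_ideal V G"
  have mono: "Poly_Mapping.single k c \<in> J" if "k \<in> Poly_Mapping.keys p" for k and c :: 'k
  proof -
    obtain g h where gh: "k = g + h" "g \<in> G"
      using p \<open>k \<in> Poly_Mapping.keys p\<close> by (auto simp: monomial_ideal_def multiples_def)
    have "Poly_Mapping.keys h \<subseteq> V"
      using p that unfolding monomial_ideal_def mpoly_ring_simps gh(1)
      by (auto simp: keys_add_nat dest!: bspec)
    then have "Poly_Mapping.single h c \<in> carrier (mpoly_ring V)"
      by (simp add: mpoly_ring_simps)
    from I_l_closed[OF G[OF gh(2)] this] show ?thesis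
      by (simp add: mpoly_ring_simps mult_single gh(1) add.commute)
  qed
  have "(\<Sum>k\<in>A. Poly_Mapping.single k (c k)) \<in> J" if "A \<subseteq> Poly_Mapping.keys p" for A and c :: "_ \<Rightarrow> 'k"
    using finite_subset[OF that finite_keys] that
  proof (induction A rule: finite_induct)
    case empty
    then show ?case using additive_subgroup.zero_closed[OF ideal.axioms(1)[OF J]]
      by (simp add: mpoly_ring_simps)
  next
    case (insert k A)
    then show ?case
      using additive_subgroup.a_closed[OF ideal.axioms(1)[OF J],
          of "Poly_Mapping.single k (c k)" "\<Sum>k\<in>A. Poly_Mapping.single k (c k)"] mono[of k]
      by (auto simp: mpoly_ring_simps)
  qed
  from this[of "Poly_Mapping.keys p" "Poly_Mapping.lookup p"] show "p \<in> J"
    by (simp add: sum_single_lookup)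
qed

lemma single_in_monomial_ideal:
  "Poly_Mapping.single m 1 \<in> monomial_ideal V G \<longleftrightarrow>
    Poly_Mapping.keys m \<subseteq> V \<and> m \<in> multiples G"
  by (simp add: monomial_ideal_def mpoly_ring_simps)

lemma generator_in_multiples: "g \<in> G \<Longrightarrow> g \<in> multiples G"
  unfolding multiples_def by (rule CollectI, rule exI[of _ g], rule exI[of _ 0]) simp

lemma genideal_monomials:
  fixes V :: "'v set"
  assumes "\<And>g. g \<in> G \<Longrightarrow> Poly_Mapping.keys g \<subseteq> V"
  shows "Idl\<^bsub>mpoly_ring V\<^esub> ((\<lambda>g. Poly_Mapping.single g (1::'k::field)) ` G) = monomial_ideal V G"
proof -
  interpret cring "mpoly_ring V :: (('v \<Rightarrow>\<^sub>0 nat) \<Rightarrow>\<^sub>0 'k::field) ring" by (rule cring_mpoly_ring)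
  let ?M = "(\<lambda>g. Poly_Mapping.single g (1::'k)) ` G"
  have sub: "?M \<subseteq> carrier (mpoly_ring V)"
    using assms by (auto simp: mpoly_ring_simps)
  show ?thesis
  proof
    show "Idl\<^bsub>mpoly_ring V\<^esub> ?M \<subseteq> monomial_ideal V G"
      using assms
      by (intro genideal_minimal ideal_monomial_ideal)
        (auto simp: single_in_monomial_ideal generator_in_multiples)
    show "monomial_ideal V G \<subseteq> Idl\<^bsub>mpoly_ring V\<^esub> ?M"
      using genideal_self[OF sub] by (intro monomial_ideal_minimal genideal_ideal[OF sub]) auto
  qed
qed

text \<open>Terms of a product may cancel, but its support stays within the sums of exponents, which
  gives one inclusion; the other only needs the products of generators.\<close>

lemma ideal_prod_monomial_ideal:
  assumes "\<And>g. g \<in> G \<Longrightarrow> Poly_Mapping.keys g \<subseteq> V" "\<And>h. h \<in> H \<Longrightarrow> Poly_Mapping.keys h \<subseteq> V"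
  shows "ideal_prod (mpoly_ring V :: (('v \<Rightarrow>\<^sub>0 nat) \<Rightarrow>\<^sub>0 'k::field) ring)
      (monomial_ideal V G) (monomial_ideal V H) = monomial_ideal V {g + h | g h. g \<in> G \<and> h \<in> H}"
    (is "?P = monomial_ideal V ?GH")
proof -
  let ?R = "mpoly_ring V :: (('v \<Rightarrow>\<^sub>0 nat) \<Rightarrow>\<^sub>0 'k::field) ring"
  interpret cring ?R by (rule cring_mpoly_ring)
  show ?thesis
  proof
    show "?P \<subseteq> monomial_ideal V ?GH"
    proof
      fix x assume "x \<in> ?P"
      then show "x \<in> monomial_ideal V ?GH"
      proof induction
        case (prod i j)
        have "i \<otimes>\<^bsub>?R\<^esub> j \<in> carrier ?R"
          using m_closed[of i j] prod by (simp add: monomial_ideal_def)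
        moreover have "Poly_Mapping.keys (i * j) \<subseteq> multiples ?GH"
        proof
          fix m assume "m \<in> Poly_Mapping.keys (i * j)"
          then obtain a b where m: "m = a + b" "a \<in> multiples G" "b \<in> multiples H"
            using subsetD[OF keys_mult, of m i j] prod unfolding monomial_ideal_def by blast
          then obtain g h g' h' where "a = g + h" "b = g' + h'" "g \<in> G" "g' \<in> H"
            by (auto simp: multiples_def)
          then have "m = (g + g') + (h + h')" "g + g' \<in> ?GH"
            using m(1) by (simp add: Groups.add_ac, blast)
          then show "m \<in> multiples ?GH"
            unfolding multiples_def by blast
        qed
        ultimately show ?case
          by (simp add: monomial_ideal_def mpoly_ring_simps(3))
      next
        case (sum s1 s2)
        then show ?case using additive_subgroup.a_closed[OF ideal.axioms(1)[OF ideal_monomial_ideal]] by blast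
      qed
    qed
    show "monomial_ideal V ?GH \<subseteq> ?P"
    proof (rule monomial_ideal_minimal)
      show "ideal ?P ?R"
        by (intro ideal_prod_is_ideal ideal_monomial_ideal)
      fix m assume "m \<in> ?GH"
      then obtain g h where m: "m = g + h" "g \<in> G" "h \<in> H" by blast
      have "Poly_Mapping.single g 1 \<otimes>\<^bsub>?R\<^esub> Poly_Mapping.single h 1 \<in> ?P"
        using assms m
        by (intro ideal_prod.prod) (auto simp: single_in_monomial_ideal generator_in_multiples)
      then show "Poly_Mapping.single m 1 \<in> ?P"
        by (simp add: mpoly_ring_simps mult_single m(1))
    qed
  qed
qed

section \<open>Ideals generated by variables: membership, primality, and when they are colon
  ideals\<close>

lemma var_ideal_eq:
  assumes "F \<subseteq> V"
  shows "var_ideal V F = monomial_ideal V ((\<lambda>i. Poly_Mapping.single i 1) ` F)"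
proof -
  have "Poly_Mapping.keys g \<subseteq> V" if "g \<in> (\<lambda>i. Poly_Mapping.single i 1) ` F" for g :: "'a \<Rightarrow>\<^sub>0 nat"
    using that assms by auto
  then have "Idl\<^bsub>mpoly_ring V\<^esub> ((\<lambda>g. Poly_Mapping.single g 1) ` (\<lambda>i. Poly_Mapping.single i 1) ` F) =
      monomial_ideal V ((\<lambda>i. Poly_Mapping.single i 1) ` F)"
    by (rule genideal_monomials)
  then show ?thesis
    by (simp add: var_ideal_def var_def[abs_def] image_image)
qed

lemma multiples_variables:
  "m \<in> multiples ((\<lambda>i. Poly_Mapping.single i 1) ` F) \<longleftrightarrow> Poly_Mapping.keys m \<inter> F \<noteq> {}"
proof
  assume "Poly_Mapping.keys m \<inter> F \<noteq> {}"
  then obtain i where i: "i \<in> F" "Poly_Mapping.lookup m i \<noteq> 0"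
    by (auto simp: in_keys_iff)
  have "m = Poly_Mapping.single i 1 + (m - Poly_Mapping.single i 1)"
    using i by (intro poly_mapping_eqI) (auto simp: lookup_add lookup_minus lookup_single when_def)
  then show "m \<in> multiples ((\<lambda>i. Poly_Mapping.single i 1) ` F)"
    using i(1) unfolding multiples_def by blast
qed (auto simp: multiples_def keys_add_nat)

lemma mem_var_ideal_iff:
  assumes "F \<subseteq> V"
  shows "p \<in> var_ideal V F \<longleftrightarrow>
    p \<in> carrier (mpoly_ring V) \<and> (\<forall>m\<in>Poly_Mapping.keys p. Poly_Mapping.keys m \<inter> F \<noteq> {})"
  unfolding var_ideal_eq[OF assms] monomial_ideal_def using multiples_variables[of _ F] by blast

text \<open>
  The terms of \<open>p\<close> and \<open>q\<close> that avoid \<open>F\<close> multiply to the part of \<open>p * q\<close> that avoids \<open>F\<close>, so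
  primality reduces to the absence of zero divisors. The library provides it for linearly ordered
  monomials, whence the sort constraint.
\<close>

lemma primeideal_var_ideal:
  fixes V F :: "'v::linorder set"
  assumes "F \<subseteq> V"
  shows "primeideal (var_ideal V F :: (('v \<Rightarrow>\<^sub>0 nat) \<Rightarrow>\<^sub>0 'k::field) set) (mpoly_ring V)"
proof (rule primeidealI)
  let ?P = "var_ideal V F :: (('v \<Rightarrow>\<^sub>0 nat) \<Rightarrow>\<^sub>0 'k::field) set"
  let ?R = "mpoly_ring V :: (('v \<Rightarrow>\<^sub>0 nat) \<Rightarrow>\<^sub>0 'k::field) ring"
  show idl: "ideal ?P ?R"
    unfolding var_ideal_eq[OF assms] by (rule ideal_monomial_ideal)
  show cr: "cring ?R" by (rule cring_mpoly_ring)
  have "1 \<in> carrier ?R" "1 \<notin> ?P"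
    by (auto simp: mem_var_ideal_iff[OF assms] mpoly_ring_simps)
  then show "carrier ?R \<noteq> ?P" by blast
  fix p q assume pq: "p \<in> carrier ?R" "q \<in> carrier ?R" "p \<otimes>\<^bsub>?R\<^esub> q \<in> ?P"
  interpret cring ?R by (rule cr)
  interpret ideal ?P ?R by (rule idl)
  \<comment> \<open>\<open>part\<close> substitutes zero for the variables in \<open>F\<close>,
    which changes a polynomial of the ring only by an element of \<open>?P\<close>.\<close>
  define part :: "(('v \<Rightarrow>\<^sub>0 nat) \<Rightarrow>\<^sub>0 'k) \<Rightarrow> ('v \<Rightarrow>\<^sub>0 nat) \<Rightarrow>\<^sub>0 'k" where
    "part r = (\<Sum>m\<in>{m \<in> Poly_Mapping.keys r. Poly_Mapping.keys m \<inter> F = {}}.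
        Poly_Mapping.single m (Poly_Mapping.lookup r m))" for r
  have lk: "Poly_Mapping.lookup (part r) m =
      (if Poly_Mapping.keys m \<inter> F = {} then Poly_Mapping.lookup r m else 0)" for r m
    by (auto simp: part_def lookup_sum lookup_single when_def sum.delta
        not_in_keys_iff_lookup_eq_zero)
  have keys_part: "Poly_Mapping.keys (part r) =
      {m \<in> Poly_Mapping.keys r. Poly_Mapping.keys m \<inter> F = {}}" for r
    unfolding set_eq_iff by (simp add: in_keys_iff[of _ r] in_keys_iff[of _ "part r"] lk) blast
  have part_carr: "part r \<in> carrier ?R" "r - part r \<in> ?P" if "r \<in> carrier ?R" for r
  proof -
    show "part r \<in> carrier ?R"
      using that by (auto simp: mpoly_ring_simps keys_part)
    have "Poly_Mapping.keys (r - part r) = {m \<in> Poly_Mapping.keys r. Poly_Mapping.keys m \<inter> F \<noteq> {}}"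
      unfolding set_eq_iff by (simp add: in_keys_iff[of _ r] in_keys_iff[of _ "r - part r"] lookup_minus lk) blast
    then show "r - part r \<in> ?P"
      using that by (auto simp: mem_var_ideal_iff[OF assms] mpoly_ring_simps)
  qed
  have "p * q - part p * part q = part q * (p - part p) + p * (q - part q)"
    by (simp add: algebra_simps)
  moreover have "part q * (p - part p) \<in> ?P" "p * (q - part q) \<in> ?P"
    using I_l_closed[OF part_carr(2)[OF pq(1)] part_carr(1)[OF pq(2)]]
      I_l_closed[OF part_carr(2)[OF pq(2)] pq(1)] by (simp_all add: mpoly_ring_simps(3))
  ultimately have "p * q - part p * part q \<in> ?P"
    using a_closed by (simp add: mpoly_ring_simps(2))
  then have "part p * part q - p * q \<in> ?P"
    using a_inv_closed[of "p * q - part p * part q"] a_inv_mpoly_ring[of "p * q - part p * part q" V]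
      Icarr by force
  then have "part p * part q \<in> ?P"
    using a_closed[of "part p * part q - p * q" "p * q"] pq(3) by (simp add: mpoly_ring_simps(2,3))
  \<comment> \<open>Every monomial of \<open>part p * part q\<close> avoids \<open>F\<close>, while
    membership in \<open>?P\<close> requires it to meet \<open>F\<close>; hence there is
    none.\<close>
  moreover have "Poly_Mapping.keys m \<inter> F = {}" if "m \<in> Poly_Mapping.keys (part p * part q)" for m
    using subsetD[OF keys_mult that] by (auto simp: keys_part keys_add_nat)
  ultimately have "Poly_Mapping.keys (part p * part q) = {}"
    by (auto simp: mem_var_ideal_iff[OF assms])
  then have "part p * part q = 0"
    by (metis poly_mapping_eqI not_in_keys_iff_lookup_eq_zero empty_iff lookup_zero)
  then have "part p = 0 \<or> part q = 0"
    by simp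
  then show "p \<in> ?P \<or> q \<in> ?P"
    using part_carr(2)[OF pq(1)] part_carr(2)[OF pq(2)] by auto
qed

text \<open>
  If no monomial of \<open>f\<close> has annihilator \<open>P\<^sub>F\<close>, each is killed by a monomial outside \<open>P\<^sub>F\<close>, and the
  product of these kills \<open>f\<close>.
\<close>

lemma associated_prime_monomial_ideal_iff:
  fixes V F :: "'v::linorder set"
  assumes F: "F \<subseteq> V"
  shows "associated_prime (mpoly_ring V :: (('v \<Rightarrow>\<^sub>0 nat) \<Rightarrow>\<^sub>0 'k::field) ring)
      (monomial_ideal V G) (var_ideal V F) \<longleftrightarrow>
    (\<exists>m. Poly_Mapping.keys m \<subseteq> V \<and> (\<forall>k. Poly_Mapping.keys k \<subseteq> V \<longrightarrow>
      (k + m \<in> multiples G \<longleftrightarrow> Poly_Mapping.keys k \<inter> F \<noteq> {})))" (is "?L \<longleftrightarrow> ?Rhs")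
proof
  let ?P = "var_ideal V F :: (('v \<Rightarrow>\<^sub>0 nat) \<Rightarrow>\<^sub>0 'k::field) set"
  let ?R = "mpoly_ring V :: (('v \<Rightarrow>\<^sub>0 nat) \<Rightarrow>\<^sub>0 'k::field) ring"
  interpret cring ?R by (rule cring_mpoly_ring)
  {
    assume ?L
    then obtain f where f: "f \<in> carrier ?R"
      and P: "?P = {r \<in> carrier ?R. r * f \<in> monomial_ideal V G}"
      by (auto simp: associated_prime_def mpoly_ring_simps(3))
    have single_P: "Poly_Mapping.single k 1 \<in> ?P \<longleftrightarrow>
        (\<forall>m\<in>Poly_Mapping.keys f. k + m \<in> multiples G)" if "Poly_Mapping.keys k \<subseteq> V" for k
    proof -
      have k: "Poly_Mapping.single k 1 \<in> carrier ?R"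
        using that by (simp add: mpoly_ring_simps)
      then have "Poly_Mapping.single k 1 * f \<in> carrier ?R"
        using m_closed[OF k f] by (simp add: mpoly_ring_simps(3))
      then show ?thesis
        using k unfolding P monomial_ideal_def Groups.mult.commute[of _ f]
        by (simp add: keys_mult_monomial image_subset_iff Groups.add.commute[of k])
    qed
    show ?Rhs
    proof (rule ccontr)
      assume neg: "\<not> ?thesis"
      have "\<exists>k. Poly_Mapping.keys k \<subseteq> V \<and> Poly_Mapping.keys k \<inter> F = {} \<and> k + m \<in> multiples G"
        if m: "m \<in> Poly_Mapping.keys f" for m
      proof -
        have "Poly_Mapping.keys m \<subseteq> V"
          using f m by (auto simp: mpoly_ring_simps)
        then obtain k where k: "Poly_Mapping.keys k \<subseteq> V"
          "\<not> (k + m \<in> multiples G \<longleftrightarrow> Poly_Mapping.keys k \<inter> F \<noteq> {})"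
          using neg by blast
        \<comment> \<open>A monomial meeting \<open>F\<close> lies in \<open>?P\<close> and kills
          all of \<open>f\<close>, so the equivalence can only fail at some \<open>k\<close>
          avoiding \<open>F\<close>.\<close>
        have "k + m \<in> multiples G" if "Poly_Mapping.keys k \<inter> F \<noteq> {}"
        proof -
          have "Poly_Mapping.single k 1 \<in> ?P"
            using that k(1) by (auto simp: mem_var_ideal_iff[OF F] mpoly_ring_simps)
          then show ?thesis using single_P[OF k(1)] m by blast
        qed
        then show ?thesis using k by blast
      qed
      then obtain u where u: "\<And>m. m \<in> Poly_Mapping.keys f \<Longrightarrow> Poly_Mapping.keys (u m) \<subseteq> V \<and>
          Poly_Mapping.keys (u m) \<inter> F = {} \<and> u m + m \<in> multiples G"
        by metis
      define K where "K = (\<Sum>m\<in>Poly_Mapping.keys f. u m)"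
      have "Poly_Mapping.keys (sum u A) \<subseteq> (\<Union>m\<in>A. Poly_Mapping.keys (u m))" if "finite A" for A
        using that by (induction A rule: finite_induct) (auto simp: keys_add_nat)
      from this[OF finite_keys[of f]]
      have K: "Poly_Mapping.keys K \<subseteq> V" "Poly_Mapping.keys K \<inter> F = {}"
        using u unfolding K_def by blast+
      have "K + m \<in> multiples G" if "m \<in> Poly_Mapping.keys f" for m
      proof -
        have "K + m = sum u (Poly_Mapping.keys f - {m}) + (u m + m)"
          unfolding K_def using that by (subst sum.remove[of _ m]) (auto simp: add_ac)
        then show ?thesis
          using add_in_multiples u[OF that] by metis
      qed
      then have "Poly_Mapping.single K 1 \<in> ?P"
        using single_P[OF K(1)] by blast
      then show False
        using K(2) by (simp add: mem_var_ideal_iff[OF F])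
    qed
  }
  {
    assume ?Rhs
    then obtain m where m: "Poly_Mapping.keys m \<subseteq> V"
      and P: "\<And>k. Poly_Mapping.keys k \<subseteq> V \<Longrightarrow>
        (k + m \<in> multiples G \<longleftrightarrow> Poly_Mapping.keys k \<inter> F \<noteq> {})"
      by blast
    \<comment> \<open>The monomial itself is the witness: multiplying by it only shifts exponents,
      so the colon ideal can be tested term by term.\<close>
    let ?f = "Poly_Mapping.single m 1 :: ('v \<Rightarrow>\<^sub>0 nat) \<Rightarrow>\<^sub>0 'k"
    have f: "?f \<in> carrier ?R"
      using m by (simp add: mpoly_ring_simps)
    have "r \<in> ?P \<longleftrightarrow> r * ?f \<in> monomial_ideal V G" if r: "r \<in> carrier ?R" for r
    proof -
      have "r * ?f \<in> carrier ?R"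
        using m_closed[OF r f] by (simp add: mpoly_ring_simps(3))
      moreover have "\<forall>k\<in>Poly_Mapping.keys r. Poly_Mapping.keys k \<subseteq> V"
        using r by (simp add: mpoly_ring_simps)
      ultimately show ?thesis
        using r P by (auto simp: mem_var_ideal_iff[OF F] monomial_ideal_def keys_mult_monomial)
    qed
    moreover have "?P \<subseteq> carrier ?R"
      by (auto simp: mem_var_ideal_iff[OF F])
    ultimately have "?P = {r \<in> carrier ?R. r \<otimes>\<^bsub>?R\<^esub> ?f \<in> monomial_ideal V G}"
      by (auto simp: mpoly_ring_simps(3))
    then show ?L
      unfolding associated_prime_def using f primeideal_var_ideal[OF F] by blast
  }
qed

section \<open>The cube of the edge ideal as a monomial ideal\<close>

abbreviation variable :: "'v \<Rightarrow> 'v \<Rightarrow>\<^sub>0 nat" where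
  "variable i \<equiv> Poly_Mapping.single i 1"

definition edge_monomials :: "'v set set \<Rightarrow> ('v \<Rightarrow>\<^sub>0 nat) set" where
  "edge_monomials E = {variable i + variable j | i j. {i, j} \<in> E}"

text \<open>The three edges may differ or repeat: these are the generators of the cube of the edge
  ideal, not just third powers.\<close>

definition edge_cubes :: "'v set set \<Rightarrow> ('v \<Rightarrow>\<^sub>0 nat) set" where
  "edge_cubes E = {e1 + e2 + e3 | e1 e2 e3.
     e1 \<in> edge_monomials E \<and> e2 \<in> edge_monomials E \<and> e3 \<in> edge_monomials E}"

lemma edge_ideal_cube:
  assumes "simple_graph V E"
  shows "(edge_ideal V E :: (('v \<Rightarrow>\<^sub>0 nat) \<Rightarrow>\<^sub>0 'k::field) set)
      [^]\<^bsub>ideals_set (mpoly_ring V)\<^esub> (3::nat) = monomial_ideal V (edge_cubes E)"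
proof -
  let ?R = "mpoly_ring V :: (('v \<Rightarrow>\<^sub>0 nat) \<Rightarrow>\<^sub>0 'k::field) ring"
  let ?M = "edge_monomials E"
  have keys: "Poly_Mapping.keys g \<subseteq> V" if "g \<in> ?M" for g
    using that assms by (fastforce simp: edge_monomials_def simple_graph_def keys_add_nat)
  have "{var i * var j | i j. {i, j} \<in> E} = (\<lambda>g. Poly_Mapping.single g (1::'k)) ` ?M"
    by (auto simp: edge_monomials_def var_def mult_single)
  then have I: "edge_ideal V E = (monomial_ideal V ?M :: (('v \<Rightarrow>\<^sub>0 nat) \<Rightarrow>\<^sub>0 'k::field) set)"
    unfolding edge_ideal_def using genideal_monomials[of ?M V] keys by simp
  \<comment> \<open>Powers in the monoid of ideals start from the whole ring, here written as the
    ideal generated by the monomial 1, whose exponent function is \<open>0\<close>.\<close>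
  have "carrier ?R = monomial_ideal V {0}"
    by (auto simp: monomial_ideal_def multiples_def)
  then have "(monomial_ideal V ?M :: (('v \<Rightarrow>\<^sub>0 nat) \<Rightarrow>\<^sub>0 'k::field) set)
      [^]\<^bsub>ideals_set ?R\<^esub> (3::nat) =
    ideal_prod ?R (ideal_prod ?R (ideal_prod ?R (monomial_ideal V {0}) (monomial_ideal V ?M))
      (monomial_ideal V ?M)) (monomial_ideal V ?M)"
    by (simp add: nat_pow_def ideals_set_def numeral_3_eq_3)
  also have "ideal_prod ?R (monomial_ideal V {0}) (monomial_ideal V ?M) = monomial_ideal V ?M"
    using ideal_prod_monomial_ideal[of "{0}" V ?M] keys by simp
  also have "ideal_prod ?R \<dots> (monomial_ideal V ?M) =
      monomial_ideal V {g + h | g h. g \<in> ?M \<and> h \<in> ?M}"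
    by (intro ideal_prod_monomial_ideal keys)
  also have "ideal_prod ?R \<dots> (monomial_ideal V ?M) =
      monomial_ideal V {g + h | g h. g \<in> {g + h | g h. g \<in> ?M \<and> h \<in> ?M} \<and> h \<in> ?M}"
    by (intro ideal_prod_monomial_ideal) (auto simp: keys_add_nat dest: subsetD[OF keys])
  also have "{g + h | g h. g \<in> {g + h | g h. g \<in> ?M \<and> h \<in> ?M} \<and> h \<in> ?M} = edge_cubes E"
    by (fastforce simp: edge_cubes_def)
  finally show ?thesis unfolding I .
qed

section \<open>Vertices missed by maximum matchings\<close>

text \<open>The relation \<open>adj\<close> is not confined to \<open>S\<close>, which is why
  \<open>no_three\<close> mentions \<open>S\<close>. Only the upper bound two is assumed;
  \<open>missable\<close> supplies matchings that attain it.\<close>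

locale matching_number_two =
  fixes S :: "'a set" and adj :: "'a \<Rightarrow> 'a \<Rightarrow> bool"
  assumes sym: "adj a b \<Longrightarrow> adj b a"
    and irrefl: "\<not> adj a a"
    and no_three: "\<lbrakk>adj a b; adj c d; adj e f; {a, b, c, d, e, f} \<subseteq> S\<rbrakk> \<Longrightarrow>
      \<not> distinct [a, b, c, d, e, f]"
begin

text \<open>A matching with two edges is maximum by \<open>no_three\<close>, so these are the
  vertices left uncovered by some maximum matching, the first class of the Gallai-Edmonds
  decomposition.\<close>

definition missable :: "'a \<Rightarrow> bool" where
  "missable w \<longleftrightarrow> (\<exists>a b c d. distinct [w, a, b, c, d] \<and> {w, a, b, c, d} \<subseteq> S \<and>
     adj a b \<and> adj c d)"

lemma missableI:
  "\<lbrakk>distinct [w, a, b, c, d]; {w, a, b, c, d} \<subseteq> S; adj a b; adj c d\<rbrakk> \<Longrightarrow> missable w"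
  unfolding missable_def by blast

text \<open>
  The symmetric difference of two matchings of size two missing \<open>u\<close> and \<open>v\<close> is an even path from
  \<open>u\<close> to \<open>v\<close>, which the edge \<open>uv\<close> closes to an odd cycle.
\<close>

lemma missable_edge:
  assumes uv: "adj u v" and u: "missable u" and v: "missable v"
  shows "(\<exists>w x y. distinct [u, v, w, x, y] \<and> {u, v, w, x, y} \<subseteq> S \<and>
      adj v w \<and> adj w u \<and> adj x y) \<or>
    (\<exists>w x y. distinct [u, v, w, x, y] \<and> {u, v, w, x, y} \<subseteq> S \<and>
      adj v w \<and> adj w x \<and> adj x y \<and> adj y u)"
proof -
  \<comment> \<open>The matching that misses \<open>p\<close> must cover its neighbor
    \<open>q\<close>, since otherwise the edge \<open>pq\<close> would extend it. Relabeling puts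
    the matching edge at \<open>q\<close> first.\<close>
  have star: "\<exists>b c d. distinct [p, q, b, c, d] \<and> {p, q, b, c, d} \<subseteq> S \<and> adj q b \<and> adj c d"
    if pq: "adj p q" and "missable p" "q \<in> S" for p q
  proof -
    obtain a b c d where M: "distinct [p, a, b, c, d]" "{p, a, b, c, d} \<subseteq> S" "adj a b" "adj c d"
      using \<open>missable p\<close> unfolding missable_def by blast
    have "q \<noteq> p" using irrefl pq by blast
    with no_three[OF pq M(3,4)] M(1,2) \<open>q \<in> S\<close> consider "q = a" | "q = b" | "q = c" | "q = d"
      by auto
    then show ?thesis
    proof cases
      case 1 then show ?thesis using M by (intro exI[of _ b] exI[of _ c] exI[of _ d]) auto
    next
      case 2 then show ?thesis using M sym[OF M(3)]
        by (intro exI[of _ a] exI[of _ c] exI[of _ d]) auto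
    next
      case 3 then show ?thesis using M by (intro exI[of _ d] exI[of _ a] exI[of _ b]) auto
    next
      case 4 then show ?thesis using M sym[OF M(4)]
        by (intro exI[of _ c] exI[of _ a] exI[of _ b]) auto
    qed
  qed
  have S: "u \<in> S" "v \<in> S"
    using u v unfolding missable_def by blast+
  obtain b c d where M: "distinct [u, v, b, c, d]" "{u, v, b, c, d} \<subseteq> S" "adj v b" "adj c d"
    using star[OF uv u S(2)] by blast
  obtain f g h where N: "distinct [v, u, f, g, h]" "{v, u, f, g, h} \<subseteq> S" "adj u f" "adj g h"
    using star[OF sym[OF uv] v S(1)] by blast
  show ?thesis
  \<comment> \<open>If the partners of \<open>u\<close> and \<open>v\<close> agree, they form a
    triangle with \<open>u\<close> and \<open>v\<close>, disjoint from the edge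
    \<open>cd\<close>.\<close>
  proof (cases "b = f")
    case True
    have "adj b u" using True N(3) sym by blast
    with M show ?thesis by blast
  next
    case False
    \<comment> \<open>Otherwise \<open>uf\<close>, \<open>vb\<close> and \<open>cd\<close> would be
      three disjoint edges. Likewise \<open>b\<close> lies on \<open>gh\<close> below.\<close>
    have "f = c \<or> f = d"
      using no_three[OF N(3) M(3,4)] M(1,2) N(1,2) False by auto
    then obtain d' where d': "adj f d'" "distinct [u, v, b, f, d']" "d' \<in> S"
    proof
      assume "f = c"
      then show thesis using M that[of d] by auto
    next
      assume "f = d"
      then show thesis using M that[of c] sym[OF M(4)] by auto
    qed
    have "b = g \<or> b = h"
      using no_three[OF N(3) M(3) N(4)] M(1,2) N(1,2) False by auto
    then obtain h' where h': "adj b h'" "distinct [v, u, f, b, h']" "h' \<in> S"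
    proof
      assume "b = g"
      then show thesis using N that[of h] by auto
    next
      assume "b = h"
      then show thesis using N that[of g] sym[OF N(4)] by auto
    qed
    \<comment> \<open>If the far ends differed, \<open>uv\<close>, \<open>fd'\<close> and
      \<open>bh'\<close> would be disjoint; their equality closes the cycle
      \<open>u, v, b, d', f\<close>.\<close>
    have "d' = h'"
      using no_three[OF uv d'(1) h'(1)] d' h' S M(2) N(2) by auto
    then have "distinct [u, v, b, d', f]" "{u, v, b, d', f} \<subseteq> S" "adj b d'" "adj d' f" "adj f u"
      using d' h' M N sym by auto
    with M(3) show ?thesis by blast
  qed
qed

end

text \<open>\<open>X\<close> is a union of components of the graph induced on the missed vertices,
  none of them a single vertex.\<close>

locale missable_part = matching_number_two +
  fixes X :: "'a set"
  assumes X_missable: "x \<in> X \<Longrightarrow> missable x"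
    and X_neighbor: "x \<in> X \<Longrightarrow> \<exists>y\<in>X. adj x y"
    and X_closed: "\<lbrakk>x \<in> X; missable y; adj x y\<rbrakk> \<Longrightarrow> y \<in> X"
begin

lemma X_subset: "X \<subseteq> S"
  using X_missable unfolding missable_def by blast

text \<open>For \<open>x\<close> in \<open>X\<close> outside \<open>C\<close>, delete from
  \<open>C\<close> a neighbor \<open>y\<close> of \<open>x\<close>, or any vertex when
  \<open>y\<close> is not in \<open>C\<close>: the two remaining edges and \<open>xy\<close> would
  be a matching of size three.\<close>

lemma X_eq_factor_critical:
  assumes C: "C \<subseteq> X"
    and critical: "\<And>c. c \<in> C \<Longrightarrow>
      \<exists>p q r s. distinct [c, p, q, r, s] \<and> C = {c, p, q, r, s} \<and> adj p q \<and> adj r s"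
    and "C \<noteq> {}"
  shows "X = C"
proof (rule ccontr)
  assume "X \<noteq> C"
  then obtain x where x: "x \<in> X" "x \<notin> C" using C by blast
  obtain y where y: "y \<in> X" "adj x y" using X_neighbor[OF x(1)] by blast
  obtain c where c: "c \<in> C" "y \<in> C \<longrightarrow> c = y" using \<open>C \<noteq> {}\<close> by blast
  obtain p q r s where pq: "distinct [c, p, q, r, s]" "C = {c, p, q, r, s}" "adj p q" "adj r s"
    using critical[OF c(1)] by blast
  have "x \<noteq> y" using irrefl y(2) by blast
  then show False
    using no_three[OF y(2) pq(3,4)] pq(1,2) x y c X_subset C by auto
qed

text \<open>Deleting any vertex of a 5-cycle leaves two disjoint edges. So the cycle is
  factor-critical and all its vertices are missed, and \<open>X_closed\<close> carries membership in
  \<open>X\<close> around from \<open>a\<close>.\<close>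

lemma X_eq_five_cycle:
  assumes dist: "distinct [a, b, c, d, e]" and S: "{a, b, c, d, e} \<subseteq> S"
    and adj: "adj a b" "adj b c" "adj c d" "adj d e" "adj e a" and "a \<in> X"
  shows "X = {a, b, c, d, e}"
proof (rule X_eq_factor_critical)
  have "missable b" "missable c" "missable d" "missable e"
    using missableI[of b c d e a] missableI[of c d e a b] missableI[of d e a b c]
      missableI[of e a b c d] dist S adj by auto
  then show "{a, b, c, d, e} \<subseteq> X"
    using X_closed \<open>a \<in> X\<close> adj by blast
  fix x assume "x \<in> {a, b, c, d, e}"
  then consider "x = a" | "x = b" | "x = c" | "x = d" | "x = e" by blast
  then show "\<exists>p q r s. distinct [x, p, q, r, s] \<and> {a, b, c, d, e} = {x, p, q, r, s} \<and>
      adj p q \<and> adj r s"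
  proof cases
    case 1 then show ?thesis using dist adj
      by (intro exI[of _ b] exI[of _ c] exI[of _ d] exI[of _ e]) auto
  next
    case 2 then show ?thesis using dist adj
      by (intro exI[of _ c] exI[of _ d] exI[of _ e] exI[of _ a]) auto
  next
    case 3 then show ?thesis using dist adj
      by (intro exI[of _ d] exI[of _ e] exI[of _ a] exI[of _ b]) auto
  next
    case 4 then show ?thesis using dist adj
      by (intro exI[of _ e] exI[of _ a] exI[of _ b] exI[of _ c]) auto
  next
    case 5 then show ?thesis using dist adj
      by (intro exI[of _ a] exI[of _ b] exI[of _ c] exI[of _ d]) auto
  qed
qed simp

text \<open>Without the center \<open>c\<close> the two outer edges remain; without an outer vertex,
  its partner is matched with \<open>c\<close>.\<close>

lemma X_eq_bowtie:
  assumes dist: "distinct [a, b, c, d, e]" and X: "{a, b, c, d, e} \<subseteq> X"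
    and adj: "adj a b" "adj b c" "adj c a" "adj c d" "adj d e" "adj e c"
  shows "X = {a, b, c, d, e}"
proof (rule X_eq_factor_critical[OF X])
  fix x assume "x \<in> {a, b, c, d, e}"
  then consider "x = a" | "x = b" | "x = c" | "x = d" | "x = e" by blast
  then show "\<exists>p q r s. distinct [x, p, q, r, s] \<and> {a, b, c, d, e} = {x, p, q, r, s} \<and>
      adj p q \<and> adj r s"
  proof cases
    case 1 then show ?thesis using dist adj
      by (intro exI[of _ b] exI[of _ c] exI[of _ d] exI[of _ e]) auto
  next
    case 2 then show ?thesis using dist adj
      by (intro exI[of _ c] exI[of _ a] exI[of _ d] exI[of _ e]) auto
  next
    case 3 then show ?thesis using dist adj
      by (intro exI[of _ a] exI[of _ b] exI[of _ d] exI[of _ e]) auto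
  next
    case 4 then show ?thesis using dist adj
      by (intro exI[of _ a] exI[of _ b] exI[of _ e] exI[of _ c]) auto
  next
    case 5 then show ?thesis using dist adj
      by (intro exI[of _ a] exI[of _ b] exI[of _ c] exI[of _ d]) auto
  qed
qed simp

text \<open>An edge meeting each triangle in at most one vertex leaves an edge free in both, which
  would give three disjoint edges. This excludes edges between the triangles as well as further
  vertices of \<open>X\<close>.\<close>

lemma X_eq_two_triangles:
  assumes dist: "distinct [a, b, c, d, e, f]" and X: "{a, b, c, d, e, f} \<subseteq> X"
    and adj: "adj a b" "adj b c" "adj c a" "adj d e" "adj e f" "adj f d"
  shows "X = {a, b, c, d, e, f} \<and> (\<forall>x\<in>{a, b, c}. \<forall>y\<in>{d, e, f}. \<not> adj x y)"
proof -
  have avoid: "\<exists>p q. adj p q \<and> p \<noteq> q \<and> {p, q} \<subseteq> {u, v, w} - {t}"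
    if "adj u v" "adj v w" "adj w u" "distinct [u, v, w]" for u v w t
    using that by (cases "t = u"; cases "t = v") auto
  have no_edge: False
    if xy: "adj x y" "x \<in> S" "y \<in> S" "{x, y} \<inter> {a, b, c} \<subseteq> {s}" "{x, y} \<inter> {d, e, f} \<subseteq> {t}"
    for x y s t
  proof -
    obtain p q where p: "adj p q" "p \<noteq> q" "{p, q} \<subseteq> {a, b, c} - {s}"
      using avoid[of a b c s] dist adj by auto
    obtain p' q' where p': "adj p' q'" "p' \<noteq> q'" "{p', q'} \<subseteq> {d, e, f} - {t}"
      using avoid[of d e f t] dist adj by auto
    have "x \<noteq> y" using irrefl xy(1) by blast
    moreover have "{p, q} \<inter> {p', q'} = {}"
      using p(3) p'(3) dist by auto
    moreover have "{x, y} \<inter> {p, q} = {}" "{x, y} \<inter> {p', q'} = {}"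
      using p(3) p'(3) xy(4,5) by blast+
    moreover have "{p, q, p', q'} \<subseteq> {a, b, c, d, e, f}"
      using p(3) p'(3) by auto
    then have "{x, y, p, q, p', q'} \<subseteq> S"
      using xy(2,3) subset_trans[OF X X_subset] by (meson insert_subset subset_trans)
    ultimately show False
      using no_three[OF xy(1) p(1) p'(1)] p(2) p'(2) by auto
  qed
  have "x \<in> {a, b, c, d, e, f}" if x: "x \<in> X" for x
  proof (rule ccontr)
    assume nx: "x \<notin> {a, b, c, d, e, f}"
    obtain y where "y \<in> X" "adj x y" using X_neighbor[OF x] by blast
    with nx show False
      using no_edge[of x y y y] x X_subset by blast
  qed
  moreover have "\<not> adj x y" if "x \<in> {a, b, c}" "y \<in> {d, e, f}" for x y
  proof
    assume "adj x y"
    then show False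
      using no_edge[of x y x y] that dist X X_subset by auto
  qed
  ultimately show ?thesis
    using X by blast
qed

text \<open>
  If two triangles share an edge, the edges completing each of them to a maximum matching meet
  in a common vertex, and a 5-cycle arises.
\<close>

lemma diamond_five_cycle:
  assumes dist: "distinct [u, v, w, z]" and S: "{u, v, w, z} \<subseteq> S"
    and adj: "adj u v" "adj v w" "adj w u" "adj z u" "adj z v"
    and xy: "adj x y" "distinct [u, v, w, x, y]" "{x, y} \<subseteq> S"
    and xy': "adj x' y'" "distinct [u, v, z, x', y']" "{x', y'} \<subseteq> S"
  shows "\<exists>t. distinct [z, t, w, u, v] \<and> t \<in> S \<and> adj z t \<and> adj t w"
proof -
  \<comment> \<open>Otherwise \<open>zu\<close>, \<open>vw\<close> and \<open>xy\<close> would be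
    disjoint. Symmetrically, \<open>wu\<close> and \<open>zv\<close> force \<open>w\<close> onto
    \<open>x'y'\<close>.\<close>
  have "z = x \<or> z = y"
    using no_three[OF adj(4) adj(2) xy(1)] dist S xy(2,3) by auto
  then obtain t where t: "adj z t" "distinct [u, v, w, z, t]" "t \<in> S"
    using xy sym[OF xy(1)] dist that[of x] that[of y] by auto
  have "w = x' \<or> w = y'"
    using no_three[OF adj(3) adj(5) xy'(1)] dist S xy'(2,3) by auto
  then obtain t' where t': "adj w t'" "distinct [u, v, w, z, t']" "t' \<in> S"
    using xy' sym[OF xy'(1)] dist that[of x'] that[of y'] by auto
  \<comment> \<open>Otherwise \<open>zt\<close>, \<open>wt'\<close> and \<open>uv\<close> would be
    disjoint.\<close>
  have "t = t'"
    using no_three[OF t(1) t'(1) adj(1)] t t' S by auto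
  then show ?thesis
    using t t' sym[OF t'(1)] by (intro exI[of _ t]) auto
qed

text \<open>A 5-cycle through a vertex of \<open>X\<close> is all of \<open>X\<close>. Without one,
  every edge of \<open>X\<close> extends to a triangle in \<open>X\<close>, no two such triangles
  share an edge, and a vertex beyond a first triangle yields a second one, either meeting it in one
  vertex or disjoint from it.\<close>

lemma X_cases:
  assumes "X \<noteq> {}"
  obtains
    (triangle) a b c where "X = {a, b, c}" "adj a b" "adj b c" "adj c a"
  | (five_cycle) a b c d e where "X = {a, b, c, d, e}"
      "adj a b" "adj b c" "adj c d" "adj d e" "adj e a"
  | (bowtie) a b c d e where "X = {a, b, c, d, e}"
      "adj a b" "adj b c" "adj c a" "adj c d" "adj d e" "adj e c"
  | (two_triangles) a b c d e f where "X = {a, b, c, d, e, f}"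
      "adj a b" "adj b c" "adj c a" "adj d e" "adj e f" "adj f d"
      "\<forall>x\<in>{a, b, c}. \<forall>y\<in>{d, e, f}. \<not> adj x y"
proof (cases "\<exists>a b c d e. distinct [a, b, c, d, e] \<and> {a, b, c, d, e} \<subseteq> S \<and> a \<in> X \<and>
    adj a b \<and> adj b c \<and> adj c d \<and> adj d e \<and> adj e a")
  case True
  then obtain a b c d e where c: "distinct [a, b, c, d, e]" "{a, b, c, d, e} \<subseteq> S" "a \<in> X"
    "adj a b" "adj b c" "adj c d" "adj d e" "adj e a" by blast
  from X_eq_five_cycle[OF c(1,2,4-8,3)] c(4-8) show thesis by (rule five_cycle)
next
  case no_cycle: False
  \<comment> \<open>Each triangle is kept together with an edge \<open>xy\<close> disjoint from it,
    as \<open>diamond_five_cycle\<close> requires.\<close>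
  define tri where "tri u v w \<longleftrightarrow> distinct [u, v, w] \<and> {u, v, w} \<subseteq> X \<and>
    adj u v \<and> adj v w \<and> adj w u \<and>
    (\<exists>x y. adj x y \<and> distinct [u, v, w, x, y] \<and> {x, y} \<subseteq> S)" for u v w
  have tri_ex: "\<exists>w. tri u v w" if uv: "u \<in> X" "v \<in> X" "adj u v" for u v
  proof -
    have "\<not> (\<exists>w x y. distinct [u, v, w, x, y] \<and> {u, v, w, x, y} \<subseteq> S \<and>
        adj v w \<and> adj w x \<and> adj x y \<and> adj y u)"
      using no_cycle uv by blast
    then obtain w x y where w: "distinct [u, v, w, x, y]" "{u, v, w, x, y} \<subseteq> S"
      "adj v w" "adj w u" "adj x y"
      using missable_edge[OF uv(3) X_missable[OF uv(1)] X_missable[OF uv(2)]] by blast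
    have "missable w"
      using missableI[of w u v x y] w uv(3) by auto
    then have "w \<in> X"
      using X_closed uv(2) w(3) by blast
    with w uv show ?thesis
      unfolding tri_def by (intro exI[of _ w]) auto
  qed
  have rot: "tri v w u" if "tri u v w" for u v w
    using that unfolding tri_def by auto
  have flip: "tri v u w" if "tri u v w" for u v w
    using that sym unfolding tri_def by auto
  have no_diamond: False if T: "tri u v w" "tri z u v" "z \<noteq> w" for u v w z
  proof -
    have T': "distinct [u, v, w, z]" "{u, v, w, z} \<subseteq> X" "adj u v" "adj v w" "adj w u" "adj z u" "adj z v"
      using T sym unfolding tri_def by auto
    obtain x y where xy: "adj x y" "distinct [u, v, w, x, y]" "{x, y} \<subseteq> S"
      using T(1) unfolding tri_def by blast
    obtain x' y' where xy': "adj x' y'" "distinct [u, v, z, x', y']" "{x', y'} \<subseteq> S"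
      using T(2) unfolding tri_def by auto
    obtain t where "distinct [z, t, w, u, v]" "t \<in> S" "adj z t" "adj t w"
      using diamond_five_cycle[OF T'(1) _ T'(3-7) xy xy'] T'(2) X_subset by blast
    moreover have "{u, v, w, z} \<subseteq> S" "z \<in> X" using T'(2) X_subset by blast+
    moreover have "adj v z" using T'(7) by (rule sym)
    ultimately have "distinct [z, t, w, u, v] \<and> {z, t, w, u, v} \<subseteq> S \<and> z \<in> X \<and>
        adj z t \<and> adj t w \<and> adj w u \<and> adj u v \<and> adj v z"
      using T'(3,5) by simp
    with no_cycle show False by blast
  qed
  have bow: thesis if T: "tri a b c" "tri c d e" "{d, e} \<inter> {a, b} = {}" for a b c d e
  proof -
    have "distinct [a, b, c, d, e]" "{a, b, c, d, e} \<subseteq> X"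
      and adj: "adj a b" "adj b c" "adj c a" "adj c d" "adj d e" "adj e c"
      using T unfolding tri_def by auto
    from X_eq_bowtie[OF this] adj show thesis by (rule bowtie)
  qed
  \<comment> \<open>The triangle on \<open>zu\<close> contains neither \<open>v\<close> nor
    \<open>w\<close> by \<open>no_diamond\<close>, so it meets the first triangle only in
    \<open>u\<close>.\<close>
  have attached: thesis if T: "tri u v w" and z: "z \<in> X" "z \<notin> {u, v, w}" "adj z u" for u v w z
  proof -
    have "u \<in> X" using T unfolding tri_def by blast
    then obtain s where s: "tri z u s" using tri_ex[OF z(1) _ z(3)] by blast
    then have "s \<noteq> u" "s \<noteq> z" unfolding tri_def by auto
    have "s \<noteq> v"
      using no_diamond[OF T, of z] s z(2) by blast
    moreover have "s \<noteq> w"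
      using no_diamond[of u w v z] flip[OF rot[OF rot[OF T]]] s z(2) by blast
    ultimately show thesis
      using bow[of v w u s z] rot[OF T] rot[OF s] z(2) \<open>s \<noteq> u\<close> by auto
  qed
  obtain u v w where T: "tri u v w"
    using assms X_neighbor tri_ex by (meson all_not_in_conv)
  show thesis
  proof (cases "X = {u, v, w}")
    case True
    from True show thesis using T unfolding tri_def by (intro triangle) auto
  next
    case False
    moreover have "{u, v, w} \<subseteq> X" using T unfolding tri_def by blast
    ultimately obtain z where z: "z \<in> X" "z \<notin> {u, v, w}" by blast
    obtain y where y: "y \<in> X" "adj z y" using X_neighbor[OF z(1)] by blast
    show thesis
    proof (cases "y \<in> {u, v, w}")
      case True
      then show thesis
        using attached[OF T z] attached[OF rot[OF T], of z] attached[OF rot[OF rot[OF T]], of z] z y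
        by auto
    next
      case y': False
      \<comment> \<open>If \<open>s\<close> lies in the first triangle, \<open>z\<close> is attached
        to it and a bowtie arises; otherwise the two triangles are disjoint.\<close>
      obtain s where s: "tri z y s" using tri_ex[OF z(1) y] by blast
      show thesis
      proof (cases "s \<in> {u, v, w}")
        case True
        then have "adj z s" using s sym unfolding tri_def by blast
        then show thesis
          using True attached[OF T z] attached[OF rot[OF T], of z]
            attached[OF rot[OF rot[OF T]], of z] z by auto
      next
        case False
        have "distinct [u, v, w, z, y, s]" "{u, v, w, z, y, s} \<subseteq> X"
          and adj: "adj u v" "adj v w" "adj w u" "adj z y" "adj y s" "adj s z"
          using T s False z y' unfolding tri_def by auto
        from X_eq_two_triangles[OF this]
        have X: "X = {u, v, w, z, y, s}" "\<forall>x\<in>{u, v, w}. \<forall>t\<in>{z, y, s}. \<not> adj x t"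
          by blast+
        show thesis by (rule two_triangles[OF X(1) adj X(2)])
      qed
    qed
  qed
qed

end

section \<open>Dominating subgraphs\<close>

text \<open>The edge set \<open>D\<close> is quantified away because the closed neighborhood depends
  on the subgraph only through \<open>W\<close>.\<close>

definition listed_subgraph :: "'v set \<Rightarrow> 'v set set \<Rightarrow> 'v set \<Rightarrow> bool" where
  "listed_subgraph V E W \<longleftrightarrow> (\<exists>D. subgraph W D V E \<and>
     (is_triangle W D \<or> is_edge_triangle_meeting W D \<or> is_nonadjacent_triangles E W D \<or>
      is_triangles_meeting W D \<or> is_pentagon W D))"

lemma edge_vertices:
  assumes "simple_graph V E" "{a, b} \<in> E"
  shows "a \<noteq> b" "a \<in> V" "b \<in> V"
  using assms by (force simp: simple_graph_def)+

lemma subgraphI: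
  assumes "simple_graph V E" "D \<subseteq> E" "\<Union> D \<subseteq> W" "W \<subseteq> V"
  shows "subgraph W D V E"
  using assms finite_subset[of W V] unfolding subgraph_def simple_graph_def by blast

lemma listed_triangle:
  assumes "simple_graph V E" "{a, b} \<in> E" "{b, c} \<in> E" "{c, a} \<in> E"
  shows "listed_subgraph V E {a, b, c}"
proof -
  let ?D = "{{a, b}, {b, c}, {c, a}}"
  have "distinct [a, b, c]" "{a, b, c} \<subseteq> V"
    using assms(2-4) edge_vertices[OF assms(1)] by auto
  moreover have "subgraph {a, b, c} ?D V E"
    using assms calculation by (intro subgraphI) auto
  moreover have "is_triangle {a, b, c} ?D"
    unfolding is_triangle_def using calculation(1) by blast
  ultimately show ?thesis unfolding listed_subgraph_def by blast
qed

text \<open>The vertex \<open>d\<close> may coincide with \<open>a\<close> or \<open>b\<close>, as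
  happens when copies of a vertex are identified; the triangle alone then remains.\<close>

lemma listed_edge_triangle:
  assumes "simple_graph V E" "{a, b} \<in> E" "{b, c} \<in> E" "{c, a} \<in> E" "{c, d} \<in> E"
  shows "listed_subgraph V E {a, b, c, d}"
proof (cases "d \<in> {a, b}")
  case True
  then have "{a, b, c, d} = {a, b, c}" by auto
  then show ?thesis using listed_triangle[OF assms(1-4)] by simp
next
  case False
  let ?D = "{{c, d}} \<union> {{a, b}, {b, c}, {c, a}}"
  have dist: "distinct [a, b, c, d]" and dist3: "distinct [a, b, c]"
    and V: "{a, b, c, d} \<subseteq> V"
    using assms(2-5) False edge_vertices[OF assms(1)] by auto
  have "subgraph {a, b, c, d} ?D V E"
    using assms V by (intro subgraphI) auto
  moreover have "is_edge {c, d} {{c, d}}"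
    unfolding is_edge_def using dist by auto
  moreover have "is_triangle {a, b, c} {{a, b}, {b, c}, {c, a}}"
    unfolding is_triangle_def using dist3 by blast
  moreover have "{c, d} \<inter> {a, b, c} = {c}" using dist by auto
  then have "card ({c, d} \<inter> {a, b, c}) = 1" by (metis card_1_singleton_iff One_nat_def)
  ultimately have "is_edge_triangle_meeting ({c, d} \<union> {a, b, c}) ?D"
    unfolding is_edge_triangle_meeting_def by blast
  moreover have "{c, d} \<union> {a, b, c} = {a, b, c, d}" by auto
  ultimately have "is_edge_triangle_meeting {a, b, c, d} ?D" by simp
  with \<open>subgraph {a, b, c, d} ?D V E\<close> show ?thesis unfolding listed_subgraph_def by blast
qed

text \<open>If the triangles share an outer vertex, the other outer vertex of the second one hangs
  on the center \<open>c\<close> by an edge, which is the case of an edge and a triangle.\<close>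

lemma listed_bowtie:
  assumes "simple_graph V E" "{a, b} \<in> E" "{b, c} \<in> E" "{c, a} \<in> E"
    "{c, d} \<in> E" "{d, e} \<in> E" "{e, c} \<in> E"
  shows "listed_subgraph V E {a, b, c, d, e}"
proof (cases "d \<in> {a, b} \<or> e \<in> {a, b}")
  case True
  then have "{a, b, c, d, e} = {a, b, c, e} \<or> {a, b, c, d, e} = {a, b, c, d}" by auto
  moreover have "{c, e} \<in> E" using assms(7) by (simp add: insert_commute)
  ultimately show ?thesis
    using listed_edge_triangle[OF assms(1-4), of e] listed_edge_triangle[OF assms(1-5)] by auto
next
  case False
  let ?S = "{{a, b}, {b, c}, {c, a}}" and ?T = "{{c, d}, {d, e}, {e, c}}"
  have dist: "distinct [a, b, c, d, e]" and dist3: "distinct [a, b, c]" "distinct [c, d, e]"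
    and V: "{a, b, c, d, e} \<subseteq> V"
    using assms(2-7) False edge_vertices[OF assms(1)] by auto
  have "subgraph {a, b, c, d, e} (?S \<union> ?T) V E"
    using assms V by (intro subgraphI) auto
  moreover have "is_triangle {a, b, c} ?S"
    unfolding is_triangle_def using dist3 by blast
  moreover have "is_triangle {c, d, e} ?T"
    unfolding is_triangle_def using dist3 by blast
  moreover have "{a, b, c} \<inter> {c, d, e} = {c}" using dist by auto
  then have "card ({a, b, c} \<inter> {c, d, e}) = 1" by (metis card_1_singleton_iff One_nat_def)
  ultimately have "is_triangles_meeting ({a, b, c} \<union> {c, d, e}) (?S \<union> ?T)"
    unfolding is_triangles_meeting_def by blast
  moreover have "{a, b, c} \<union> {c, d, e} = {a, b, c, d, e}" by auto
  ultimately have "is_triangles_meeting {a, b, c, d, e} (?S \<union> ?T)" by simp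
  with \<open>subgraph {a, b, c, d, e} (?S \<union> ?T) V E\<close> show ?thesis
    unfolding listed_subgraph_def by blast
qed

text \<open>Identifying two vertices of the closed walk leaves a triangle with at most one further edge.\<close>

lemma listed_closed_walk:
  assumes G: "simple_graph V E"
    and E: "{a, b} \<in> E" "{b, c} \<in> E" "{c, d} \<in> E" "{d, e} \<in> E" "{e, a} \<in> E"
  shows "listed_subgraph V E {a, b, c, d, e}"
proof -
  have collapsed: "listed_subgraph V E {p, q, r, s, t}"
    if "p = r" "{p, q} \<in> E" "{r, s} \<in> E" "{s, t} \<in> E" "{t, p} \<in> E" for p q r s t
  proof -
    have "{p, q, r, s, t} = {s, t, p, q}" using that(1) by auto
    then show ?thesis using listed_edge_triangle[OF G that(4,5), of q] that by simp
  qed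
  show ?thesis
  proof (cases "distinct [a, b, c, d, e]")
    case True
    let ?D = "{{a, b}, {b, c}, {c, d}, {d, e}, {e, a}}"
    have "{a, b, c, d, e} \<subseteq> V" using E edge_vertices[OF G] by auto
    then have "subgraph {a, b, c, d, e} ?D V E"
      using G E by (intro subgraphI) auto
    moreover have "is_pentagon {a, b, c, d, e} ?D"
      unfolding is_pentagon_def using True by blast
    ultimately show ?thesis unfolding listed_subgraph_def by blast
  next
    case False
    \<comment> \<open>There are no loops, so coinciding positions are at distance two on the walk,
      and a rotation brings them to the front.\<close>
    moreover have "a \<noteq> b" "b \<noteq> c" "c \<noteq> d" "d \<noteq> e" "e \<noteq> a"
      using E edge_vertices[OF G] by blast+
    ultimately consider "a = c" | "b = d" | "c = e" | "d = a" | "e = b" by auto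
    then show ?thesis
    proof cases
      case 1 from collapsed[OF this E(1,3-5)] show ?thesis .
    next
      case 2 from collapsed[OF this E(2,4,5,1)] show ?thesis by (simp add: insert_commute)
    next
      case 3 from collapsed[OF this E(3,5,1,2)] show ?thesis by (simp add: insert_commute)
    next
      case 4 from collapsed[OF this E(4,1,2,3)] show ?thesis by (simp add: insert_commute)
    next
      case 5 from collapsed[OF this E(5,2,3,4)] show ?thesis by (simp add: insert_commute)
    qed
  qed
qed

lemma listed_nonadjacent_triangles:
  assumes "simple_graph V E" "{a, b} \<in> E" "{b, c} \<in> E" "{c, a} \<in> E"
    "{d, e} \<in> E" "{e, f} \<in> E" "{f, d} \<in> E"
    and nonadj: "\<forall>x\<in>{a, b, c}. \<forall>y\<in>{d, e, f}. {x, y} \<notin> E"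
  shows "listed_subgraph V E {a, b, c, d, e, f}"
proof -
  let ?S = "{{a, b}, {b, c}, {c, a}}" and ?T = "{{d, e}, {e, f}, {f, d}}"
  have dist: "distinct [a, b, c]" "distinct [d, e, f]" and V: "{a, b, c, d, e, f} \<subseteq> V"
    using assms(2-7) edge_vertices[OF assms(1)] by auto
  \<comment> \<open>A common vertex would be adjacent to another vertex of the second triangle,
    contrary to \<open>nonadj\<close>.\<close>
  have "{a, b, c} \<inter> {d, e, f} = {}"
  proof (rule ccontr)
    assume "{a, b, c} \<inter> {d, e, f} \<noteq> {}"
    then obtain x where x: "x \<in> {a, b, c}" "x \<in> {d, e, f}" by blast
    then have "{x, e} \<in> E \<or> {x, d} \<in> E" using assms(5-7) by (auto simp: insert_commute)
    then show False using x nonadj by blast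
  qed
  moreover have sub: "subgraph {a, b, c, d, e, f} (?S \<union> ?T) V E"
    using assms V by (intro subgraphI) auto
  moreover have "is_triangle {a, b, c} ?S"
    unfolding is_triangle_def using dist by blast
  moreover have "is_triangle {d, e, f} ?T"
    unfolding is_triangle_def using dist by blast
  ultimately have "is_nonadjacent_triangles E ({a, b, c} \<union> {d, e, f}) (?S \<union> ?T)"
    unfolding is_nonadjacent_triangles_def using nonadj by blast
  moreover have "{a, b, c} \<union> {d, e, f} = {a, b, c, d, e, f}" by auto
  ultimately have "is_nonadjacent_triangles E {a, b, c, d, e, f} (?S \<union> ?T)" by simp
  with sub show ?thesis unfolding listed_subgraph_def by blast
qed

section \<open>Edges of a listed subgraph, labeled with a shared vertex in a fixed position\<close>

lemma is_triangle_at: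
  assumes "is_triangle W D" "c \<in> W"
  shows "\<exists>a b. distinct [a, b, c] \<and> W = {a, b, c} \<and> D = {{a, b}, {b, c}, {c, a}}"
proof -
  obtain x y z where T: "distinct [x, y, z]" "W = {x, y, z}" "D = {{x, y}, {y, z}, {z, x}}"
    using assms(1) unfolding is_triangle_def by blast
  then consider "x = c" | "y = c" | "z = c" using assms(2) by blast
  then show ?thesis
  proof cases
    case 1
    with T have "distinct [y, z, c] \<and> W = {y, z, c} \<and> D = {{y, z}, {z, c}, {c, y}}"
      by (auto simp: insert_commute)
    then show ?thesis by blast
  next
    case 2
    with T have "distinct [z, x, c] \<and> W = {z, x, c} \<and> D = {{z, x}, {x, c}, {c, z}}"
      by (auto simp: insert_commute)
    then show ?thesis by blast
  next
    case 3
    with T have "distinct [x, y, c] \<and> W = {x, y, c} \<and> D = {{x, y}, {y, c}, {c, x}}"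
      by (auto simp: insert_commute)
    then show ?thesis by blast
  qed
qed

lemma listed_subgraph_cases:
  assumes "listed_subgraph V E W"
  obtains
    (triangle) a b c where "W = {a, b, c}" "{a, b} \<in> E" "{b, c} \<in> E" "{c, a} \<in> E"
  | (edge_triangle) a b c d where "W = {a, b, c, d}"
      "{a, b} \<in> E" "{b, c} \<in> E" "{c, a} \<in> E" "{c, d} \<in> E"
  | (bowtie) a b c d e where "W = {a, b, c, d, e}"
      "{a, b} \<in> E" "{b, c} \<in> E" "{c, a} \<in> E" "{c, d} \<in> E" "{d, e} \<in> E" "{e, c} \<in> E"
  | (pentagon) a b c d e where "W = {a, b, c, d, e}"
      "{a, b} \<in> E" "{b, c} \<in> E" "{c, d} \<in> E" "{d, e} \<in> E" "{e, a} \<in> E"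
  | (nonadjacent) a b c d e f where "W = {a, b, c, d, e, f}" "distinct [a, b, c, d, e, f]"
      "{a, b} \<in> E" "{b, c} \<in> E" "{c, a} \<in> E" "{d, e} \<in> E" "{e, f} \<in> E" "{f, d} \<in> E"
      "\<forall>x\<in>{a, b, c}. \<forall>y\<in>{d, e, f}. {x, y} \<notin> E"
proof -
  obtain D where D: "D \<subseteq> E" and forms: "is_triangle W D \<or> is_edge_triangle_meeting W D \<or>
      is_nonadjacent_triangles E W D \<or> is_triangles_meeting W D \<or> is_pentagon W D"
    using assms unfolding listed_subgraph_def subgraph_def by blast
  from forms consider "is_triangle W D" | "is_edge_triangle_meeting W D" |
    "is_nonadjacent_triangles E W D" | "is_triangles_meeting W D" | "is_pentagon W D"
    by blast
  then show thesis
  proof cases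
    case 1
    then obtain a b c where "W = {a, b, c}" "D = {{a, b}, {b, c}, {c, a}}"
      unfolding is_triangle_def by blast
    with D show thesis by (intro triangle[of a b c]) auto
  next
    case 2
    then obtain A B C T where W: "is_edge A B" "is_triangle C T" "card (A \<inter> C) = 1"
      "W = A \<union> C" "D = B \<union> T"
      unfolding is_edge_triangle_meeting_def by blast
    obtain c where "A \<inter> C = {c}" using W(3) by (rule card_1_singletonE)
    then have c: "c \<in> A" "c \<in> C" by blast+
    obtain a b where T: "C = {a, b, c}" "T = {{a, b}, {b, c}, {c, a}}"
      using is_triangle_at[OF W(2) c(2)] by blast
    obtain d where "A = {c, d}" "B = {{c, d}}"
      using W(1) c(1) unfolding is_edge_def by (auto simp: insert_commute)
    with T W(4,5) D show thesis by (intro edge_triangle[of a b c d]) auto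
  next
    case 3
    then obtain A S C T where W: "is_triangle A S" "is_triangle C T" "A \<inter> C = {}"
      "\<forall>x\<in>A. \<forall>y\<in>C. {x, y} \<notin> E" "W = A \<union> C" "D = S \<union> T"
      unfolding is_nonadjacent_triangles_def by blast
    obtain a b c where A: "distinct [a, b, c]" "A = {a, b, c}" "S = {{a, b}, {b, c}, {c, a}}"
      using W(1) unfolding is_triangle_def by blast
    obtain d e f where C: "distinct [d, e, f]" "C = {d, e, f}" "T = {{d, e}, {e, f}, {f, d}}"
      using W(2) unfolding is_triangle_def by blast
    have "W = {a, b, c, d, e, f}" "distinct [a, b, c, d, e, f]"
      using A C W(3,5) by auto
    with A C W(4,6) D show thesis by (intro nonadjacent[of a b c d e f]) auto
  next
    case 4
    then obtain A S C T where W: "is_triangle A S" "is_triangle C T" "card (A \<inter> C) = 1"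
      "W = A \<union> C" "D = S \<union> T"
      unfolding is_triangles_meeting_def by blast
    obtain c where "A \<inter> C = {c}" using W(3) by (rule card_1_singletonE)
    then have c: "c \<in> A" "c \<in> C" by blast+
    obtain a b where A: "A = {a, b, c}" "S = {{a, b}, {b, c}, {c, a}}"
      using is_triangle_at[OF W(1) c(1)] by blast
    obtain d e where C: "C = {d, e, c}" "T = {{d, e}, {e, c}, {c, d}}"
      using is_triangle_at[OF W(2) c(2)] by blast
    from A C W(4,5) D show thesis by (intro bowtie[of a b c d e]) auto
  next
    case 5
    then obtain a b c d e where "W = {a, b, c, d, e}"
      "D = {{a, b}, {b, c}, {c, d}, {d, e}, {e, a}}"
      unfolding is_pentagon_def by blast
    with D show thesis by (intro pentagon[of a b c d e]) auto
  qed
qed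

section \<open>Products of three edges\<close>

abbreviation monomial :: "'v list \<Rightarrow> 'v \<Rightarrow>\<^sub>0 nat" where
  "monomial vs \<equiv> sum_list (map variable vs)"

lemma edge_monomial_at:
  assumes "g \<in> edge_monomials E" "i \<in> Poly_Mapping.keys g"
  shows "\<exists>b. {i, b} \<in> E \<and> g = variable i + variable b"
proof -
  obtain x y where g: "{x, y} \<in> E" "g = variable x + variable y"
    using assms(1) by (auto simp: edge_monomials_def)
  then consider "i = x" | "i = y" using assms(2) by (auto simp: keys_add_nat)
  then show ?thesis
  proof cases
    case 1 then show ?thesis using g by blast
  next
    case 2
    then have "{i, x} \<in> E" unfolding 2 using g(1) by (simp add: insert_commute)
    moreover have "g = variable i + variable x"
      unfolding 2 g(2) by (rule Groups.add.commute)
    ultimately show ?thesis by blast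
  qed
qed

lemma multiples_edge_cubes_iff:
  "m \<in> multiples (edge_cubes E) \<longleftrightarrow>
    (\<exists>a b c d e f h. {a, b} \<in> E \<and> {c, d} \<in> E \<and> {e, f} \<in> E \<and> m = monomial [a, b, c, d, e, f] + h)"
proof
  assume "m \<in> multiples (edge_cubes E)"
  then obtain e1 e2 e3 h where m: "m = e1 + e2 + e3 + h"
    "e1 \<in> edge_monomials E" "e2 \<in> edge_monomials E" "e3 \<in> edge_monomials E"
    by (auto simp: multiples_def edge_cubes_def)
  then obtain a b c d e f where ed: "{a, b} \<in> E" "{c, d} \<in> E" "{e, f} \<in> E" and
    e: "e1 = variable a + variable b" "e2 = variable c + variable d" "e3 = variable e + variable f"
    by (auto simp: edge_monomials_def)
  have "m = monomial [a, b, c, d, e, f] + h"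
    unfolding m(1) e by (simp add: add_ac)
  with ed show "\<exists>a b c d e f h. {a, b} \<in> E \<and> {c, d} \<in> E \<and> {e, f} \<in> E \<and>
      m = monomial [a, b, c, d, e, f] + h" by blast
next
  assume "\<exists>a b c d e f h. {a, b} \<in> E \<and> {c, d} \<in> E \<and> {e, f} \<in> E \<and>
      m = monomial [a, b, c, d, e, f] + h"
  then obtain a b c d e f h where ed: "{a, b} \<in> E" "{c, d} \<in> E" "{e, f} \<in> E"
    and m: "m = monomial [a, b, c, d, e, f] + h" by blast
  have "(variable a + variable b) + (variable c + variable d) + (variable e + variable f)
      \<in> edge_cubes E"
    unfolding edge_cubes_def edge_monomials_def using ed by blast
  moreover have "m = ((variable a + variable b) + (variable c + variable d) +
      (variable e + variable f)) + h"
    unfolding m by (simp add: add_ac)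
  ultimately show "m \<in> multiples (edge_cubes E)"
    unfolding multiples_def by blast
qed

lemma edge_cubesI:
  assumes "{a, b} \<in> E" "{c, d} \<in> E" "{e, f} \<in> E" "m = monomial [a, b, c, d, e, f] + h"
  shows "m \<in> multiples (edge_cubes E)"
  by (rule multiples_edge_cubes_iff[THEN iffD2]) (intro exI conjI, (rule assms)+)

text \<open>A variable that does not occur in \<open>g\<close> must divide the cofactor
  \<open>h\<close>.\<close>

lemma cancel_variable:
  fixes m g :: "'v \<Rightarrow>\<^sub>0 nat"
  assumes "variable i + m = g + h" "i \<notin> Poly_Mapping.keys g"
  shows "\<exists>h'. m = g + h'"
proof -
  have lk: "(if i = v then 1 else 0) + Poly_Mapping.lookup m v =
      Poly_Mapping.lookup g v + Poly_Mapping.lookup h v" for v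
    using arg_cong[OF assms(1), of "\<lambda>p. Poly_Mapping.lookup p v"]
    by (simp add: lookup_add lookup_single when_def split: if_splits)
  have "m = g + (h - variable i)"
  proof (rule poly_mapping_eqI)
    fix v
    show "Poly_Mapping.lookup m v = Poly_Mapping.lookup (g + (h - variable i)) v"
      using lk[of v] assms(2)
      by (cases "i = v") (simp_all add: lookup_add lookup_minus lookup_single in_keys_iff)
  qed
  then show ?thesis by blast
qed

text \<open>A product of three edges dividing the left-hand monomial must involve \<open>i\<close>,
  since otherwise it would divide \<open>m\<close>. Removing \<open>i\<close> from its edge leaves a
  single vertex \<open>b\<close> and two edges: this \<open>b\<close> is the source of the missed
  vertices.\<close>

lemma edge_cubes_new_variable:
  fixes m :: "'v \<Rightarrow>\<^sub>0 nat"
  assumes "variable i + m \<in> multiples (edge_cubes E)" "m \<notin> multiples (edge_cubes E)"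
  shows "\<exists>b c d e f h. {i, b} \<in> E \<and> {c, d} \<in> E \<and> {e, f} \<in> E \<and> m = monomial [b, c, d, e, f] + h"
proof -
  obtain e1 e2 e3 h where m: "variable i + m = (e1 + e2 + e3) + h"
    "e1 \<in> edge_monomials E" "e2 \<in> edge_monomials E" "e3 \<in> edge_monomials E"
    using assms(1) by (auto simp: multiples_def edge_cubes_def)
  have "e1 + e2 + e3 \<in> edge_cubes E"
    using m(2-4) by (auto simp: edge_cubes_def)
  then have "i \<in> Poly_Mapping.keys (e1 + e2 + e3)"
    using cancel_variable[OF m(1)] assms(2) unfolding multiples_def by blast
  then consider "i \<in> Poly_Mapping.keys e1" | "i \<in> Poly_Mapping.keys e2" | "i \<in> Poly_Mapping.keys e3"
    by (auto simp: keys_add_nat)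
  then obtain g1 g2 g3 where g: "i \<in> Poly_Mapping.keys g1" "g1 \<in> edge_monomials E"
    "g2 \<in> edge_monomials E" "g3 \<in> edge_monomials E" "variable i + m = g1 + (g2 + g3 + h)"
  proof cases
    case 1 then show thesis using m that[of e1 e2 e3] by (simp add: add_ac)
  next
    case 2 then show thesis using m that[of e2 e1 e3] by (simp add: add_ac)
  next
    case 3 then show thesis using m that[of e3 e1 e2] by (simp add: add_ac)
  qed
  obtain b where b: "{i, b} \<in> E" "g1 = variable i + variable b"
    using edge_monomial_at[OF g(2,1)] by blast
  obtain c d e f where ed: "{c, d} \<in> E" "{e, f} \<in> E"
    and e: "g2 = variable c + variable d" "g3 = variable e + variable f"
    using g(3,4) by (auto simp: edge_monomials_def)
  have "m = monomial [b, c, d, e, f] + h"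
    by (rule add_left_imp_eq[of "variable i"])
      (simp only: g(5) b(2) e, simp add: add_ac)
  with b(1) ed show ?thesis by blast
qed

text \<open>A monomial meeting \<open>F\<close> is a multiple of a variable in \<open>F\<close>, so
  on that side variables suffice; for monomials avoiding \<open>F\<close>, arbitrary powers of the
  outside variables have to be tested.\<close>

lemma associated_prime_cube_iff:
  fixes V F :: "'v::linorder set"
  assumes "simple_graph V E" "F \<subseteq> V"
  shows "associated_prime (mpoly_ring V :: (('v \<Rightarrow>\<^sub>0 nat) \<Rightarrow>\<^sub>0 'k::field) ring)
      (edge_ideal V E [^]\<^bsub>ideals_set (mpoly_ring V)\<^esub> (3::nat)) (var_ideal V F) \<longleftrightarrow>
    (\<exists>m. Poly_Mapping.keys m \<subseteq> V \<and>
      (\<forall>i\<in>F. variable i + m \<in> multiples (edge_cubes E)) \<and>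
      (\<forall>k. Poly_Mapping.keys k \<subseteq> V - F \<longrightarrow> k + m \<notin> multiples (edge_cubes E)))"
  unfolding edge_ideal_cube[OF assms(1)] associated_prime_monomial_ideal_iff[OF assms(2)]
proof (intro ex_cong1 conj_cong refl)
  fix m :: "'v \<Rightarrow>\<^sub>0 nat"
  have "k + m \<in> multiples (edge_cubes E)"
    if i: "\<forall>i\<in>F. variable i + m \<in> multiples (edge_cubes E)" "Poly_Mapping.keys k \<inter> F \<noteq> {}" for k
  proof -
    have "k \<in> multiples (variable ` F)"
      using that(2) multiples_variables[of k F] by simp
    then obtain i h where "k = variable i + h" "i \<in> F"
      by (auto simp: multiples_def)
    then show ?thesis
      using add_in_multiples[of "variable i + m" _ h] i(1) by (simp add: add_ac)
  qed
  then show "(\<forall>k. Poly_Mapping.keys k \<subseteq> V \<longrightarrow>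
        (k + m \<in> multiples (edge_cubes E)) = (Poly_Mapping.keys k \<inter> F \<noteq> {})) \<longleftrightarrow>
      (\<forall>i\<in>F. variable i + m \<in> multiples (edge_cubes E)) \<and>
      (\<forall>k. Poly_Mapping.keys k \<subseteq> V - F \<longrightarrow> k + m \<notin> multiples (edge_cubes E))"
      (is "?L \<longleftrightarrow> ?R")
  proof (intro iffI)
    assume L: ?L
    have "variable i + m \<in> multiples (edge_cubes E)" if "i \<in> F" for i
      using L[rule_format, of "variable i"] that assms(2) by auto
    moreover have "k + m \<notin> multiples (edge_cubes E)" if "Poly_Mapping.keys k \<subseteq> V - F" for k
      using L[rule_format, of k] that by blast
    ultimately show ?R by blast
  qed blast
qed

section \<open>Monomials realizing the listed subgraphs\<close>

text \<open>Additivity of this partial degree turns degree bounds into bounds on the number of edge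
  factors.\<close>

definition deg_on :: "'v set \<Rightarrow> ('v \<Rightarrow>\<^sub>0 nat) \<Rightarrow> nat" where
  "deg_on A m = (\<Sum>v\<in>A. Poly_Mapping.lookup m v)"

lemma deg_on_add: "deg_on A (m + m') = deg_on A m + deg_on A m'"
  by (simp add: deg_on_def lookup_add sum.distrib)

lemma deg_on_variable: "finite A \<Longrightarrow> deg_on A (variable i) = (if i \<in> A then 1 else 0)"
  by (simp add: deg_on_def lookup_single when_def)

lemma deg_on_eq_0: "Poly_Mapping.keys m \<inter> A = {} \<Longrightarrow> deg_on A m = 0"
  unfolding deg_on_def by (intro sum.neutral) (auto simp: in_keys_iff)

text \<open>A product of three edges has degree six.\<close>

lemma short_monomial_notin_edge_cubes:
  assumes "simple_graph V E" "set vs \<subseteq> V" "length vs \<le> 5"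
  shows "monomial vs \<notin> multiples (edge_cubes E)"
proof
  assume "monomial vs \<in> multiples (edge_cubes E)"
  then obtain a b c d e f h where *: "{a, b} \<in> E" "{c, d} \<in> E" "{e, f} \<in> E"
    "monomial vs = monomial [a, b, c, d, e, f] + h"
    unfolding multiples_edge_cubes_iff by blast
  have "finite V" using assms(1) by (simp add: simple_graph_def)
  have "deg_on V (monomial vs) = length vs"
    using assms(2) by (induction vs)
      (simp_all add: deg_on_add deg_on_variable[OF \<open>finite V\<close>, simplified] deg_on_def[of _ 0])
  moreover have "deg_on V (monomial [a, b, c, d, e, f]) = 6"
    using *(1-3)[THEN edge_vertices(2)[OF assms(1)]] *(1-3)[THEN edge_vertices(3)[OF assms(1)]]
    by (simp add: deg_on_add deg_on_variable[OF \<open>finite V\<close>, simplified] deg_on_def[of _ 0])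
  ultimately show False
    using *(4) assms(3) by (simp add: deg_on_add)
qed

text \<open>Each edge dividing the product lies inside one triangle and uses two of the three
  degrees available there, so each triangle has room for one edge only.\<close>

lemma two_triangles_notin_edge_cubes:
  assumes G: "simple_graph V E" and dist: "distinct [a, b, c, d, e, f]"
    and nonadj: "\<forall>x\<in>{a, b, c}. \<forall>y\<in>{d, e, f}. {x, y} \<notin> E"
  shows "monomial [a, b, c, d, e, f] \<notin> multiples (edge_cubes E)"
proof
  let ?m = "monomial [a, b, c, d, e, f]"
  let ?A = "{a, b, c}" and ?C = "{d, e, f}"
  assume "?m \<in> multiples (edge_cubes E)"
  then obtain e1 e2 e3 h where m: "?m = e1 + e2 + e3 + h"
    "e1 \<in> edge_monomials E" "e2 \<in> edge_monomials E" "e3 \<in> edge_monomials E"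
    by (auto simp: multiples_def edge_cubes_def)
  have keys_m: "Poly_Mapping.keys ?m = {a, b, c, d, e, f}"
    by (auto simp: keys_add_nat)
  have deg: "deg_on ?A g = 2 \<and> deg_on ?C g = 0 \<or> deg_on ?A g = 0 \<and> deg_on ?C g = 2"
    if g: "g \<in> edge_monomials E" "Poly_Mapping.keys g \<subseteq> {a, b, c, d, e, f}" for g
  proof -
    obtain x y where xy: "{x, y} \<in> E" "g = variable x + variable y"
      using g(1) by (auto simp: edge_monomials_def)
    have "x \<in> ?A \<union> ?C" "y \<in> ?A \<union> ?C"
      using g(2) unfolding xy(2) by (auto simp: keys_add_nat)
    moreover have "\<not> (x \<in> ?A \<and> y \<in> ?C)" "\<not> (x \<in> ?C \<and> y \<in> ?A)"
      using nonadj xy(1) insert_commute[of x y "{}"] by auto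
    moreover have "?A \<inter> ?C = {}" using dist by auto
    ultimately have "x \<in> ?A \<and> y \<in> ?A \<and> x \<notin> ?C \<and> y \<notin> ?C \<or> x \<notin> ?A \<and> y \<notin> ?A \<and> x \<in> ?C \<and> y \<in> ?C"
      by blast
    moreover have "finite ?A" "finite ?C" by simp_all
    ultimately show ?thesis
      unfolding xy(2) deg_on_add deg_on_variable[OF \<open>finite ?A\<close>] deg_on_variable[OF \<open>finite ?C\<close>]
      by (elim disjE conjE) simp_all
  qed
  have "Poly_Mapping.keys (e1 + e2 + e3 + h) = {a, b, c, d, e, f}"
    using keys_m m(1) by simp
  then have "Poly_Mapping.keys e1 \<subseteq> {a, b, c, d, e, f}"
    "Poly_Mapping.keys e2 \<subseteq> {a, b, c, d, e, f}" "Poly_Mapping.keys e3 \<subseteq> {a, b, c, d, e, f}"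
    unfolding keys_add_nat by blast+
  note degs = deg[OF m(2) this(1)] deg[OF m(3) this(2)] deg[OF m(4) this(3)]
  have "deg_on ?A ?m = 3" "deg_on ?C ?m = 3"
    using dist by (auto simp: deg_on_def lookup_add lookup_single when_def)
  then have "deg_on ?A e1 + deg_on ?A e2 + deg_on ?A e3 \<le> 3"
    "deg_on ?C e1 + deg_on ?C e2 + deg_on ?C e3 \<le> 3"
    unfolding m(1) deg_on_add by linarith+
  with degs show False by linarith
qed

lemma listed_subgraph_neighbor:
  assumes "listed_subgraph V E W" "w \<in> W"
  shows "\<exists>x\<in>W. {x, w} \<in> E"
  using assms(1) by (cases rule: listed_subgraph_cases) (use assms(2) in \<open>auto simp: insert_commute\<close>)

lemma listed_subgraph_nonempty: "listed_subgraph V E W \<Longrightarrow> W \<noteq> {}"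
  by (erule listed_subgraph_cases) simp_all

text \<open>For each \<open>w\<close> in \<open>W\<close> the chosen monomial is \<open>w\<close>
  times two edges, with a spare vertex for two non-adjacent triangles; a neighbor \<open>i\<close>
  of \<open>w\<close> completes the third edge.\<close>

lemma listed_subgraph_monomial:
  assumes G: "simple_graph V E" and W: "listed_subgraph V E W"
  shows "\<exists>m. Poly_Mapping.keys m \<subseteq> W \<and> m \<notin> multiples (edge_cubes E) \<and>
    (\<forall>i. \<forall>w\<in>W. {i, w} \<in> E \<longrightarrow> variable i + m \<in> multiples (edge_cubes E))"
proof -
  have comm: "{y, x} \<in> E" if "{x, y} \<in> E" for x y
    using that by (simp add: insert_commute)
  define completed where "completed vs w \<longleftrightarrow>
    (\<exists>p q r s. {p, q} \<in> E \<and> {r, s} \<in> E \<and> monomial vs = monomial [w, p, q, r, s])" for vs w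
  have completedI: "completed vs w"
    if "{p, q} \<in> E" "{r, s} \<in> E" "monomial vs = monomial [w, p, q, r, s]" for vs w p q r s
    using that unfolding completed_def by blast
  have witness: ?thesis
    if vs: "set vs = W" "monomial vs \<notin> multiples (edge_cubes E)" "\<forall>w\<in>W. completed vs w" for vs
  proof (intro exI[of _ "monomial vs"] conjI allI ballI impI)
    have "Poly_Mapping.keys (monomial us) \<subseteq> set us" for us :: "'a list"
      by (induction us) (auto simp: keys_add_nat)
    then show "Poly_Mapping.keys (monomial vs) \<subseteq> W" using vs(1) by blast
    fix i w assume w: "w \<in> W" "{i, w} \<in> E"
    obtain p q r s where "{p, q} \<in> E" "{r, s} \<in> E" "monomial vs = monomial [w, p, q, r, s]"
      using vs(3) w(1) unfolding completed_def by blast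
    with w(2) show "variable i + monomial vs \<in> multiples (edge_cubes E)"
      by (intro edge_cubesI[of i w E p q r s _ 0]) simp_all
  qed (rule vs(2))
  show ?thesis
    using W
  proof (cases rule: listed_subgraph_cases)
    case (triangle a b c)
    note e = triangle(2-4) triangle(2-4)[THEN comm]
    \<comment> \<open>Squaring two vertices brings the degree to five: enough for two edges beside
      any vertex, too little for three edges.\<close>
    let ?vs = "[a, a, b, b, c]"
    have "completed ?vs a" by (rule completedI[of a b b c]) (use e in \<open>simp_all add: add_ac\<close>)
    moreover have "completed ?vs b" by (rule completedI[of a b a c]) (use e in \<open>simp_all add: add_ac\<close>)
    moreover have "completed ?vs c" by (rule completedI[of a b a b]) (use e in \<open>simp_all add: add_ac\<close>)
    moreover have "{a, b, c} \<subseteq> V" using e edge_vertices[OF G] by blast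
    then have "monomial ?vs \<notin> multiples (edge_cubes E)"
      by (intro short_monomial_notin_edge_cubes[OF G]) auto
    ultimately show ?thesis
      using triangle(1) by (intro witness[of ?vs]) simp_all
  next
    case (edge_triangle a b c d)
    note e = edge_triangle(2-5) edge_triangle(2-5)[THEN comm]
    let ?vs = "[a, b, c, c, d]"
    have "completed ?vs a" by (rule completedI[of b c c d]) (use e in \<open>simp_all add: add_ac\<close>)
    moreover have "completed ?vs b" by (rule completedI[of a c c d]) (use e in \<open>simp_all add: add_ac\<close>)
    moreover have "completed ?vs c" by (rule completedI[of a b c d]) (use e in \<open>simp_all add: add_ac\<close>)
    moreover have "completed ?vs d" by (rule completedI[of a c b c]) (use e in \<open>simp_all add: add_ac\<close>)
    moreover have "{a, b, c, d} \<subseteq> V" using e edge_vertices[OF G] by blast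
    then have "monomial ?vs \<notin> multiples (edge_cubes E)"
      by (intro short_monomial_notin_edge_cubes[OF G]) auto
    ultimately show ?thesis
      using edge_triangle(1) by (intro witness[of ?vs]) simp_all
  next
    case (bowtie a b c d f)
    note e = bowtie(2-7) bowtie(2-7)[THEN comm]
    let ?vs = "[a, b, c, d, f]"
    have "completed ?vs a" by (rule completedI[of b c d f]) (use e in \<open>simp_all add: add_ac\<close>)
    moreover have "completed ?vs b" by (rule completedI[of a c d f]) (use e in \<open>simp_all add: add_ac\<close>)
    moreover have "completed ?vs c" by (rule completedI[of a b d f]) (use e in \<open>simp_all add: add_ac\<close>)
    moreover have "completed ?vs d" by (rule completedI[of a b c f]) (use e in \<open>simp_all add: add_ac\<close>)
    moreover have "completed ?vs f" by (rule completedI[of a b c d]) (use e in \<open>simp_all add: add_ac\<close>)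
    moreover have "{a, b, c, d, f} \<subseteq> V" using e edge_vertices[OF G] by blast
    then have "monomial ?vs \<notin> multiples (edge_cubes E)"
      by (intro short_monomial_notin_edge_cubes[OF G]) auto
    ultimately show ?thesis
      using bowtie(1) by (intro witness[of ?vs]) simp_all
  next
    case (pentagon a b c d f)
    note e = pentagon(2-6) pentagon(2-6)[THEN comm]
    let ?vs = "[a, b, c, d, f]"
    have "completed ?vs a" by (rule completedI[of b c d f]) (use e in \<open>simp_all add: add_ac\<close>)
    moreover have "completed ?vs b" by (rule completedI[of c d f a]) (use e in \<open>simp_all add: add_ac\<close>)
    moreover have "completed ?vs c" by (rule completedI[of d f a b]) (use e in \<open>simp_all add: add_ac\<close>)
    moreover have "completed ?vs d" by (rule completedI[of f a b c]) (use e in \<open>simp_all add: add_ac\<close>)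
    moreover have "completed ?vs f" by (rule completedI[of a b c d]) (use e in \<open>simp_all add: add_ac\<close>)
    moreover have "{a, b, c, d, f} \<subseteq> V" using e edge_vertices[OF G] by blast
    then have "monomial ?vs \<notin> multiples (edge_cubes E)"
      by (intro short_monomial_notin_edge_cubes[OF G]) auto
    ultimately show ?thesis
      using pentagon(1) by (intro witness[of ?vs]) simp_all
  next
    case (nonadjacent a b c d f g)
    note e = nonadjacent(3-8) nonadjacent(3-8)[THEN comm]
    \<comment> \<open>Degree six no longer excludes three edges; the odd size of the two
      non-adjacent triangles does.\<close>
    let ?m = "monomial [a, b, c, d, f, g]"
    have nb: "variable i + ?m \<in> multiples (edge_cubes E)" if iw: "{i, w} \<in> E" "w \<in> W" for i w
    proof -
      consider "w = a" | "w = b" | "w = c" | "w = d" | "w = f" | "w = g"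
        using iw(2) nonadjacent(1) by blast
      then show ?thesis
      proof cases
        case 1 then show ?thesis using iw(1) e
          by (intro edge_cubesI[of i a E b c d f _ "variable g"]) (simp_all add: add_ac)
      next
        case 2 then show ?thesis using iw(1) e
          by (intro edge_cubesI[of i b E c a d f _ "variable g"]) (simp_all add: add_ac)
      next
        case 3 then show ?thesis using iw(1) e
          by (intro edge_cubesI[of i c E a b d f _ "variable g"]) (simp_all add: add_ac)
      next
        case 4 then show ?thesis using iw(1) e
          by (intro edge_cubesI[of i d E f g a b _ "variable c"]) (simp_all add: add_ac)
      next
        case 5 then show ?thesis using iw(1) e
          by (intro edge_cubesI[of i f E g d a b _ "variable c"]) (simp_all add: add_ac)
      next
        case 6 then show ?thesis using iw(1) e
          by (intro edge_cubesI[of i g E d f a b _ "variable c"]) (simp_all add: add_ac)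
      qed
    qed
    have "Poly_Mapping.keys ?m = W"
      using nonadjacent(1) by (auto simp: keys_add_nat)
    then show ?thesis
      using two_triangles_notin_edge_cubes[OF G nonadjacent(2,9)] nb by blast
  qed
qed

section \<open>Associated primes from listed subgraphs\<close>

text \<open>Dropping \<open>i\<close> keeps \<open>N\<close> inside, so by minimality it uncovers an
  edge, whose other end must lie outside \<open>F\<close>.\<close>

lemma minimal_cover_containing_outside_neighbor:
  assumes G: "simple_graph V E" and F: "minimal_cover_containing V E N F"
    and i: "i \<in> F" "i \<notin> N"
  obtains j where "j \<in> V - F" "{i, j} \<in> E"
proof -
  have cov: "cover V E F" "N \<subseteq> F - {i}"
    using F i unfolding minimal_cover_containing_def by blast+
  have "F - {i} \<subset> F" using i by blast
  then have "\<not> cover V E (F - {i})"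
    using F cov unfolding minimal_cover_containing_def by blast
  then obtain g where g: "g \<in> E" "g \<inter> (F - {i}) = {}"
    using cov(1) unfolding cover_def by blast
  moreover have "g \<inter> F \<noteq> {}" using cov(1) g(1) unfolding cover_def by blast
  ultimately have "i \<in> g" by blast
  moreover have "g \<subseteq> V" "card g = 2" using G g(1) unfolding simple_graph_def by blast+
  ultimately obtain j where "g = {i, j}" "i \<noteq> j"
    by (auto simp: card_2_iff insert_commute)
  with g \<open>g \<subseteq> V\<close> show thesis by (intro that[of j]) auto
qed

lemma minimal_cover_associated_monomial:
  assumes G: "simple_graph V E" and F: "minimal_cover V E F"
  shows "\<exists>m. Poly_Mapping.keys m \<subseteq> V \<and>
    (\<forall>i\<in>F. variable i + m \<in> multiples (edge_cubes E)) \<and>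
    (\<forall>k. Poly_Mapping.keys k \<subseteq> V - F \<longrightarrow> k + m \<notin> multiples (edge_cubes E))"
proof (cases "F = {}")
  \<comment> \<open>An empty cover means that there are no edges; the cube is the zero ideal and the
    monomial 1 works.\<close>
  case True
  then have "E = {}"
    using F unfolding minimal_cover_def cover_def by blast
  then have "multiples (edge_cubes E) = {}"
    by (simp add: multiples_def edge_cubes_def edge_monomials_def)
  with True show ?thesis by (intro exI[of _ 0]) simp
next
  case False
  have fin: "finite V" "F \<subseteq> V" and cov: "cover V E F"
    using G F by (auto simp: simple_graph_def minimal_cover_def cover_def)
  then have "finite F" using finite_subset by blast
  have F': "minimal_cover_containing V E {} F"
    using F by (simp add: minimal_cover_def minimal_cover_containing_def)
  obtain i0 where i0: "i0 \<in> F" using False by blast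
  \<comment> \<open>Every edge needs a factor from \<open>F\<close>, so the square of
    \<open>i0\<close> admits two edges but not three. The exponent is 3 because \<open>j\<close> and
    \<open>j0\<close> may coincide below, which uses the variable \<open>j0\<close> three
    times.\<close>
  define u where "u = (\<Sum>j\<in>V - F. Poly_Mapping.single j (3::nat))"
  have u: "Poly_Mapping.lookup u j = (if j \<in> V - F then 3 else 0)" for j
    using fin(1) by (auto simp: u_def lookup_sum lookup_single when_def sum.delta')
  let ?m = "variable i0 + variable i0 + u"
  have "Poly_Mapping.keys ?m \<subseteq> V"
    using i0 fin(2) by (auto simp: keys_add_nat) (auto simp: in_keys_iff u split: if_splits)
  moreover have "variable i + ?m \<in> multiples (edge_cubes E)" if i: "i \<in> F" for i
  proof -
    obtain j where j: "j \<in> V - F" "{i, j} \<in> E"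
      using minimal_cover_containing_outside_neighbor[OF G F' i] by blast
    obtain j0 where j0: "j0 \<in> V - F" "{i0, j0} \<in> E"
      using minimal_cover_containing_outside_neighbor[OF G F' i0] by blast
    have split: "u = monomial [j, j0, j0] + (u - monomial [j, j0, j0])"
      using j(1) j0(1) by (intro poly_mapping_eqI)
        (auto simp: lookup_add lookup_minus lookup_single when_def u)
    then have "variable i + ?m = monomial [i, j, i0, j0, i0, j0] + (u - monomial [j, j0, j0])"
      by (subst split) (simp add: add_ac)
    with j(2) j0(2) show ?thesis by (intro edge_cubesI)
  qed
  moreover have "k + ?m \<notin> multiples (edge_cubes E)" if k: "Poly_Mapping.keys k \<subseteq> V - F" for k
  proof
    assume "k + ?m \<in> multiples (edge_cubes E)"
    then obtain e1 e2 e3 h where m: "k + ?m = e1 + e2 + e3 + h"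
      "e1 \<in> edge_monomials E" "e2 \<in> edge_monomials E" "e3 \<in> edge_monomials E"
      by (auto simp: multiples_def edge_cubes_def)
    have "deg_on F g \<ge> 1" if "g \<in> edge_monomials E" for g
      using that cov by (auto simp: edge_monomials_def cover_def deg_on_add
          deg_on_variable[OF \<open>finite F\<close>, simplified])
    from this[OF m(2)] this[OF m(3)] this[OF m(4)]
    have "deg_on F (k + ?m) \<ge> 3"
      unfolding m(1) deg_on_add by linarith
    moreover have "deg_on F k = 0" "deg_on F u = 0"
      using k by (auto intro!: deg_on_eq_0 simp: in_keys_iff u)
    ultimately show False
      using i0 by (simp add: deg_on_add deg_on_variable[OF \<open>finite F\<close>, simplified])
  qed
  ultimately show ?thesis by blast
qed

text \<open>The monomial of \<open>W\<close> is multiplied by the vertices outside \<open>F\<close>.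
  They complete edges at the vertices of \<open>F\<close> beyond the closed neighborhood, but form
  no edge with \<open>W\<close>, whose neighbors all lie in \<open>F\<close>.\<close>

lemma listed_subgraph_associated_monomial:
  assumes G: "simple_graph V E" and WV: "W \<subseteq> V" and W: "listed_subgraph V E W"
    and F: "minimal_cover_containing V E (closed_nbhd V E W) F"
  shows "\<exists>m. Poly_Mapping.keys m \<subseteq> V \<and>
    (\<forall>i\<in>F. variable i + m \<in> multiples (edge_cubes E)) \<and>
    (\<forall>k. Poly_Mapping.keys k \<subseteq> V - F \<longrightarrow> k + m \<notin> multiples (edge_cubes E))"
proof -
  have fin: "finite V" and cov: "cover V E F" and NF: "closed_nbhd V E W \<subseteq> F"
    using G F by (auto simp: simple_graph_def minimal_cover_containing_def)
  obtain m where m: "Poly_Mapping.keys m \<subseteq> W" "m \<notin> multiples (edge_cubes E)"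
    and nb: "\<And>i w. w \<in> W \<Longrightarrow> {i, w} \<in> E \<Longrightarrow> variable i + m \<in> multiples (edge_cubes E)"
    using listed_subgraph_monomial[OF G W] by blast
  obtain i0 w0 where i0: "{i0, w0} \<in> E" "w0 \<in> W"
    using listed_subgraph_neighbor[OF W] listed_subgraph_nonempty[OF W] by blast
  \<comment> \<open>Removing the edge at \<open>i0\<close> exhibits two edges whose product divides
    \<open>m\<close>; they are used beside an edge leaving \<open>F\<close>.\<close>
  obtain b c d e f h where ed: "{c, d} \<in> E" "{e, f} \<in> E" and mh: "m = monomial [b, c, d, e, f] + h"
    using edge_cubes_new_variable[OF nb[OF i0(2,1)] m(2)] by blast
  define u where "u = (\<Sum>j\<in>V - F. variable j)"
  have u: "Poly_Mapping.lookup u j = (if j \<in> V - F then 1 else 0)" for j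
    using fin(1) by (auto simp: u_def lookup_sum lookup_single when_def sum.delta')
  have "Poly_Mapping.keys u \<subseteq> V - F"
    by (auto simp: in_keys_iff u split: if_splits)
  have neighbors: "y \<in> W" if "{x, y} \<in> E" "x \<in> W" "y \<in> W \<union> (V - F)" for x y
  proof -
    have "y \<in> V" using edge_vertices[OF G that(1)] by blast
    then have "y \<in> F" using that(1,2) NF by (auto simp: closed_nbhd_def)
    then show ?thesis using that(3) by blast
  qed
  have "Poly_Mapping.keys (m + u) \<subseteq> V"
    using m(1) WV \<open>Poly_Mapping.keys u \<subseteq> V - F\<close> by (auto simp: keys_add_nat)
  moreover have "variable i + (m + u) \<in> multiples (edge_cubes E)" if i: "i \<in> F" for i
  proof (cases "\<exists>w\<in>W. {i, w} \<in> E")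
    case True
    then show ?thesis
      using add_in_multiples[OF nb, of _ i u] by (auto simp: add_ac)
  next
    case False
    \<comment> \<open>Every vertex of \<open>W\<close> has a neighbor in \<open>W\<close>, so
      \<open>i\<close> lies outside the closed neighborhood and minimality of \<open>F\<close>
      provides a neighbor outside \<open>F\<close>.\<close>
    then have "i \<notin> W"
      using listed_subgraph_neighbor[OF W, of i] by (auto simp: insert_commute)
    with False have "i \<notin> closed_nbhd V E W"
      by (auto simp: closed_nbhd_def insert_commute)
    then obtain j where j: "j \<in> V - F" "{i, j} \<in> E"
      using minimal_cover_containing_outside_neighbor[OF G F i] by blast
    have split: "u = variable j + (u - variable j)"
      using j(1) by (intro poly_mapping_eqI) (auto simp: lookup_add lookup_minus lookup_single when_def u)
    then have "variable i + (m + u) = monomial [i, j, c, d, e, f] + (variable b + h + (u - variable j))"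
      unfolding mh by (subst split) (simp add: add_ac)
    with j(2) ed show ?thesis by (intro edge_cubesI)
  qed
  moreover have "k + (m + u) \<notin> multiples (edge_cubes E)" if k: "Poly_Mapping.keys k \<subseteq> V - F" for k
  proof
    assume "k + (m + u) \<in> multiples (edge_cubes E)"
    then obtain e1 e2 e3 h where eq: "k + (m + u) = (e1 + e2 + e3) + h"
      and e: "e1 \<in> edge_monomials E" "e2 \<in> edge_monomials E" "e3 \<in> edge_monomials E"
      by (auto simp: multiples_def edge_cubes_def)
    have "Poly_Mapping.keys (k + (m + u)) \<subseteq> W \<union> (V - F)"
      using k m(1) \<open>Poly_Mapping.keys u \<subseteq> V - F\<close> by (auto simp: keys_add_nat)
    then have sub: "Poly_Mapping.keys g \<subseteq> W \<union> (V - F)" if "g \<in> {e1, e2, e3}" for g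
      unfolding eq keys_add_nat using that by blast
    \<comment> \<open>An edge dividing the monomial meets \<open>F\<close>, hence has an end in
      \<open>W\<close>, and then both ends.\<close>
    have "Poly_Mapping.keys g \<subseteq> W" if g: "g \<in> {e1, e2, e3}" for g
    proof -
      obtain x y where xy: "{x, y} \<in> E" "g = variable x + variable y"
        using g e by (auto simp: edge_monomials_def)
      then have keys: "Poly_Mapping.keys g = {x, y}" by (auto simp: keys_add_nat)
      have "{x, y} \<inter> F \<noteq> {}" using cov xy(1) unfolding cover_def by blast
      then have "x \<in> F \<or> y \<in> F" by simp
      then show ?thesis
        using sub[OF g] neighbors[of x y] neighbors[of y x] xy(1) unfolding keys
        by (auto simp: insert_commute)
    qed
    then have W3: "Poly_Mapping.keys (e1 + e2 + e3) \<subseteq> W" by (simp add: keys_add_nat)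
    have "W \<subseteq> F" using NF by (auto simp: closed_nbhd_def)
    \<comment> \<open>On \<open>W\<close> the factors \<open>k\<close> and \<open>u\<close> have
      exponent zero, so the three edges divide \<open>m\<close> alone.\<close>
    have "m = (e1 + e2 + e3) + (m - (e1 + e2 + e3))"
    proof (rule poly_mapping_eqI)
      fix v
      have "Poly_Mapping.lookup (k + (m + u)) v = Poly_Mapping.lookup ((e1 + e2 + e3) + h) v"
        using eq by simp
      moreover have "Poly_Mapping.lookup k v = 0 \<and> Poly_Mapping.lookup u v = 0" if "v \<in> W"
        using that \<open>W \<subseteq> F\<close> k u by (auto simp: in_keys_iff)
      moreover have "Poly_Mapping.lookup (e1 + e2 + e3) v = 0" if "v \<notin> W"
        using that W3 by (auto simp: in_keys_iff)
      ultimately show "Poly_Mapping.lookup m v =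
          Poly_Mapping.lookup ((e1 + e2 + e3) + (m - (e1 + e2 + e3))) v"
        by (cases "v \<in> W") (auto simp: lookup_add lookup_minus)
    qed
    moreover have "e1 + e2 + e3 \<in> edge_cubes E"
      using e by (auto simp: edge_cubes_def)
    ultimately show False
      using m(2) unfolding multiples_def by blast
  qed
  ultimately show ?thesis by blast
qed

section \<open>Listed subgraphs from associated primes\<close>

definition copies :: "('v \<Rightarrow>\<^sub>0 nat) \<Rightarrow> ('v \<times> nat) set" where
  "copies m = {(v, k). k < Poly_Mapping.lookup m v}"

lemma lookup_monomial: "Poly_Mapping.lookup (monomial vs) v = count_list vs v"
  by (induction vs) (auto simp: lookup_add lookup_single when_def)

lemma count_list_copies:
  "distinct ps \<Longrightarrow> count_list (map fst ps) v = card {p \<in> set ps. fst p = v}"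
proof (induction ps)
  case (Cons q ps)
  have "{p \<in> set (q # ps). fst p = v} =
      (if fst q = v then insert q {p \<in> set ps. fst p = v} else {p \<in> set ps. fst p = v})"
    by auto
  then show ?case using Cons by auto
qed simp

lemma copies_fiber: "{p \<in> copies m. fst p = v} = {v} \<times> {..<Poly_Mapping.lookup m v}"
  by (auto simp: copies_def)

text \<open>Distinct copies over \<open>v\<close> number at most the exponent of \<open>v\<close> in
  \<open>m\<close>.\<close>

lemma monomial_of_copies:
  assumes "distinct ps" "set ps \<subseteq> copies m"
  shows "\<exists>h. m = monomial (map fst ps) + h"
proof (intro exI poly_mapping_eqI)
  fix v
  have "{p \<in> set ps. fst p = v} \<subseteq> {v} \<times> {..<Poly_Mapping.lookup m v}"
    using assms(2) copies_fiber[of m v] by blast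
  from card_mono[OF _ this] have "count_list (map fst ps) v \<le> Poly_Mapping.lookup m v"
    by (simp add: count_list_copies[OF assms(1)] card_cartesian_product)
  then show "Poly_Mapping.lookup m v =
      Poly_Mapping.lookup (monomial (map fst ps) + (m - monomial (map fst ps))) v"
    unfolding lookup_add lookup_minus lookup_monomial by simp
qed

lemma copies_of_monomial:
  assumes "m = monomial vs + h"
  obtains ps where "distinct ps" "set ps \<subseteq> copies m" "map fst ps = vs"
proof -
  have "\<exists>ps. distinct ps \<and> set ps \<subseteq> copies m \<and> map fst ps = vs"
    using assms
  proof (induction vs arbitrary: h)
    case (Cons v vs)
    then have "m = monomial vs + (variable v + h)" by (simp add: add_ac)
    then obtain ps where ps: "distinct ps" "set ps \<subseteq> copies m" "map fst ps = vs"
      using Cons.IH by blast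
    have "count_list (map fst ps) v < Poly_Mapping.lookup m v"
      unfolding Cons.prems ps(3) by (simp add: lookup_add lookup_monomial[unfolded One_nat_def])
    then have lt: "card {p \<in> set ps. fst p = v} < card ({v} \<times> {..<Poly_Mapping.lookup m v})"
      by (simp add: count_list_copies[OF ps(1)] card_cartesian_product)
    have "\<not> {v} \<times> {..<Poly_Mapping.lookup m v} \<subseteq> {p \<in> set ps. fst p = v}"
    proof
      assume "{v} \<times> {..<Poly_Mapping.lookup m v} \<subseteq> {p \<in> set ps. fst p = v}"
      from card_mono[OF _ this] lt show False by simp
    qed
    then obtain k where "k < Poly_Mapping.lookup m v" "(v, k) \<notin> set ps" by auto
    then have "distinct ((v, k) # ps) \<and> set ((v, k) # ps) \<subseteq> copies m \<and>
        map fst ((v, k) # ps) = v # vs"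
      using ps by (auto simp: copies_def)
    then show ?case by (rule exI)
  qed (intro exI[of _ "[]"], simp)
  with that show thesis by blast
qed

text \<open>
  Replacing each variable of \<open>m\<close> by as many copies as its exponent turns edge products dividing
  \<open>m\<close> into matchings.
\<close>

lemma associated_monomial_listed_subgraph:
  fixes m :: "'v \<Rightarrow>\<^sub>0 nat"
  assumes G: "simple_graph V E" and cov: "cover V E F"
    and gen: "\<And>i. i \<in> F \<Longrightarrow> variable i + m \<in> multiples (edge_cubes E)"
    and out: "\<And>k. Poly_Mapping.keys k \<subseteq> V - F \<Longrightarrow> k + m \<notin> multiples (edge_cubes E)"
    and not_min: "\<not> minimal_cover V E F"
  shows "\<exists>W. W \<subseteq> V \<and> listed_subgraph V E W \<and>
    minimal_cover_containing V E (closed_nbhd V E W) F"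
proof -
  define S where "S = copies m"
  define adj where "adj p q \<longleftrightarrow> {fst p, fst q} \<in> E" for p q :: "'v \<times> nat"
  define B where "B = {b \<in> F. \<forall>j\<in>V - F. {b, j} \<notin> E}"
  have FV: "F \<subseteq> V" using cov by (simp add: cover_def)
  have m: "m \<notin> multiples (edge_cubes E)" using out[of 0] by simp
  have no_loop: "{a} \<notin> E" for a
    using edge_vertices(1)[OF G, of a a] by auto
  interpret matching_number_two S adj
  proof
    fix a b c d e f assume *: "adj a b" "adj c d" "adj e f" "{a, b, c, d, e, f} \<subseteq> S"
    show "\<not> distinct [a, b, c, d, e, f]"
    proof
      assume "distinct [a, b, c, d, e, f]"
      moreover have "set [a, b, c, d, e, f] \<subseteq> copies m" using *(4) by (simp add: S_def)
      ultimately obtain h where "m = monomial (map fst [a, b, c, d, e, f]) + h"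
        using monomial_of_copies by blast
      then have "m = monomial [fst a, fst b, fst c, fst d, fst e, fst f] + h" by simp
      then have "m \<in> multiples (edge_cubes E)"
        using *(1-3) unfolding adj_def by (intro edge_cubesI)
      with m show False by blast
    qed
  qed (use no_loop in \<open>auto simp: adj_def insert_commute\<close>)
  \<comment> \<open>The factorization of \<open>variable i + m\<close> leaves a neighbor
    \<open>b\<close> of \<open>i\<close> and two edges inside \<open>m\<close>; lifted to distinct
    copies, the two edges miss the copy of \<open>b\<close>.\<close>
  have missable_neighbor: "\<exists>w. missable w \<and> {i, fst w} \<in> E" if i: "i \<in> F" for i
  proof -
    obtain b c d e f h where ed: "{i, b} \<in> E" "{c, d} \<in> E" "{e, f} \<in> E"
      and "m = monomial [b, c, d, e, f] + h"
      using edge_cubes_new_variable[OF gen[OF i] m] by blast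
    then obtain ps where ps: "distinct ps" "set ps \<subseteq> S" "map fst ps = [b, c, d, e, f]"
      using copies_of_monomial unfolding S_def by blast
    then obtain p1 p2 p3 p4 p5 where p: "ps = [p1, p2, p3, p4, p5]"
      by (auto simp: map_eq_Cons_conv)
    have "missable p1"
      using ps ed unfolding p by (intro missableI[of p1 p2 p3 p4 p5]) (auto simp: adj_def)
    moreover have "{i, fst p1} \<in> E" using ed(1) ps(3) unfolding p by simp
    ultimately show ?thesis by blast
  qed
  \<comment> \<open>If a missed vertex over \<open>F\<close> had a neighbor \<open>j\<close> outside
    \<open>F\<close>, then multiplying \<open>m\<close> by \<open>j\<close> would complete three
    edges, contrary to \<open>out\<close>.\<close>
  have missable_B: "fst w \<in> B" if w: "missable w" "fst w \<in> F" for w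
  proof (rule ccontr)
    assume "fst w \<notin> B"
    then obtain j where j: "j \<in> V - F" "{fst w, j} \<in> E" using w(2) by (auto simp: B_def)
    obtain a b c d where *: "distinct [w, a, b, c, d]" "{w, a, b, c, d} \<subseteq> S" "adj a b" "adj c d"
      using w(1) unfolding missable_def by blast
    have "set [w, a, b, c, d] \<subseteq> copies m" using *(2) by (simp add: S_def)
    then obtain h where "m = monomial (map fst [w, a, b, c, d]) + h"
      using monomial_of_copies[OF *(1)] by blast
    then have "variable j + m = monomial [fst w, j, fst a, fst b, fst c, fst d] + h"
      by (simp add: add_ac)
    then have "variable j + m \<in> multiples (edge_cubes E)"
      using j(2) *(3,4) unfolding adj_def by (intro edge_cubesI)
    then show False using out[of "variable j"] j(1) by simp
  qed
  have B_neighbor: "y \<in> F" if "x \<in> B" "{x, y} \<in> E" for x y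
    using that edge_vertices(3)[OF G that(2)] by (auto simp: B_def)
  define X where "X = {w. missable w \<and> fst w \<in> B}"
  have dominated: "\<exists>w\<in>X. {b, fst w} \<in> E" if "b \<in> B" for b
    using missable_neighbor[of b] missable_B B_neighbor[OF that] that by (auto simp: X_def B_def)
  \<comment> \<open>Neighbors of \<open>B\<close> lie in \<open>F\<close>, and missed copies over
    \<open>F\<close> lie over \<open>B\<close>; hence \<open>X\<close> is closed and each of its
    members has a neighbor in it.\<close>
  interpret missable_part S adj X
  proof
    show "missable x" if "x \<in> X" for x using that by (simp add: X_def)
    show "\<exists>y\<in>X. adj x y" if "x \<in> X" for x
      using dominated[of "fst x"] that by (auto simp: X_def adj_def)
    show "y \<in> X" if "x \<in> X" "missable y" "adj x y" for x y
      using that B_neighbor[of "fst x" "fst y"] missable_B[of y] by (simp add: X_def adj_def)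
  qed
  have "B \<noteq> {}"
  proof
    assume "B = {}"
    have "\<not> cover V E H" if H: "H \<subset> F" for H
    proof
      assume "cover V E H"
      obtain x where x: "x \<in> F" "x \<notin> H" using H by blast
      then obtain j where "j \<in> V - F" "{x, j} \<in> E" using \<open>B = {}\<close> by (auto simp: B_def)
      moreover have "{x, j} \<inter> H \<noteq> {}" using \<open>cover V E H\<close> calculation(2) by (auto simp: cover_def)
      ultimately show False using x H by blast
    qed
    with cov not_min show False by (auto simp: minimal_cover_def)
  qed
  then have "X \<noteq> {}" using dominated by blast
  \<comment> \<open>Projecting copies to vertices may identify some of them, which the lemmas on
    listed subgraphs allow for.\<close>
  define W where "W = fst ` X"
  have "listed_subgraph V E W"
    using \<open>X \<noteq> {}\<close>
  proof (cases rule: X_cases)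
    case (triangle a b c)
    then show ?thesis
      using listed_triangle[OF G, of "fst a" "fst b" "fst c"] by (simp add: W_def adj_def)
  next
    case (five_cycle a b c d e)
    then show ?thesis
      using listed_closed_walk[OF G, of "fst a" "fst b" "fst c" "fst d" "fst e"]
      by (simp add: W_def adj_def)
  next
    case (bowtie a b c d e)
    then show ?thesis
      using listed_bowtie[OF G, of "fst a" "fst b" "fst c" "fst d" "fst e"]
      by (simp add: W_def adj_def)
  next
    case (two_triangles a b c d e f)
    then show ?thesis
      using listed_nonadjacent_triangles[OF G,
          of "fst a" "fst b" "fst c" "fst d" "fst e" "fst f"]
      by (simp add: W_def adj_def)
  qed
  moreover have WB: "W \<subseteq> B" by (auto simp: W_def X_def)
  moreover have "minimal_cover_containing V E (closed_nbhd V E W) F"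
    unfolding minimal_cover_containing_def
  proof (intro conjI allI impI notI)
    show "cover V E F" by (rule cov)
    have "B \<subseteq> F" by (auto simp: B_def)
    with WB B_neighbor show "closed_nbhd V E W \<subseteq> F"
      unfolding closed_nbhd_def by blast
    fix H assume H: "H \<subset> F" "cover V E H \<and> closed_nbhd V E W \<subseteq> H"
    then obtain x where x: "x \<in> F" "x \<notin> H" by blast
    \<comment> \<open>A vertex of \<open>F\<close> missing from \<open>H\<close> is therefore not in
      \<open>B\<close>, so it has an edge leaving \<open>F\<close>, and \<open>H\<close> fails to
      cover that edge.\<close>
    have "B \<subseteq> closed_nbhd V E W"
    proof
      fix b assume "b \<in> B"
      then obtain w where "w \<in> X" "{b, fst w} \<in> E" using dominated by blast
      moreover have "b \<in> V" using \<open>b \<in> B\<close> FV by (auto simp: B_def)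
      ultimately show "b \<in> closed_nbhd V E W"
        by (auto simp: closed_nbhd_def W_def insert_commute)
    qed
    with x H have "x \<notin> B" by blast
    then obtain j where "j \<in> V - F" "{x, j} \<in> E" using x(1) by (auto simp: B_def)
    moreover have "{x, j} \<inter> H \<noteq> {}" using H(2) calculation(2) by (auto simp: cover_def)
    ultimately show False using x H by blast
  qed
  moreover have "B \<subseteq> V" using FV by (auto simp: B_def)
  ultimately show ?thesis by blast
qed

theorem theorem4p4:
  fixes n :: nat
    and V F :: "nat set"
    and E :: "nat set set"
    and R :: "((nat \<Rightarrow>\<^sub>0 nat) \<Rightarrow>\<^sub>0 'k::field) ring"
    and I :: "((nat \<Rightarrow>\<^sub>0 nat) \<Rightarrow>\<^sub>0 'k) set"
  assumes "n \<ge> 1"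
    and "V = {1..n}"
    and "R = mpoly_ring V"
    and "simple_graph V E"
    and "I = edge_ideal V E"
    and "cover V E F"
  shows "associated_prime R (I [^]\<^bsub>ideals_set R\<^esub> (3::nat)) (var_ideal V F) \<longleftrightarrow>
    minimal_cover V E F \<or>
    (\<exists>W D. subgraph W D V E \<and>
       (is_triangle W D \<or> is_edge_triangle_meeting W D \<or> is_nonadjacent_triangles E W D \<or>
        is_triangles_meeting W D \<or> is_pentagon W D) \<and>
       minimal_cover_containing V E (closed_nbhd V E W) F)"
    (is "?L \<longleftrightarrow> _ \<or> ?W")
proof -
  have FV: "F \<subseteq> V" using assms(6) by (simp add: cover_def)
  have L: "?L \<longleftrightarrow> (\<exists>m. Poly_Mapping.keys m \<subseteq> V \<and>
      (\<forall>i\<in>F. variable i + m \<in> multiples (edge_cubes E)) \<and>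
      (\<forall>k. Poly_Mapping.keys k \<subseteq> V - F \<longrightarrow> k + m \<notin> multiples (edge_cubes E)))"
    unfolding assms(3,5) by (rule associated_prime_cube_iff[OF assms(4) FV])
  have W: "?W \<longleftrightarrow> (\<exists>W. W \<subseteq> V \<and> listed_subgraph V E W \<and>
      minimal_cover_containing V E (closed_nbhd V E W) F)"
    unfolding listed_subgraph_def subgraph_def by blast
  show ?thesis
    unfolding L W
    using associated_monomial_listed_subgraph[OF assms(4,6)]
      minimal_cover_associated_monomial[OF assms(4)]
      listed_subgraph_associated_monomial[OF assms(4)]
    by meson
qed

end
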